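(* Let $\Gamma$ be a geometric triangulation of a simplex $\Delta$ of dimension at least $3$ whose local $h$-polynomial $\ell(\Gamma;x)=\sum_i \ell_i x^i$ satisfies $\ell_1=\ell_2=0$. Then every connected component of the internal edge graph of $\Gamma$ is a tree, and each such tree contains exactly one vertex carried by a face of $\Delta$ of codimension at least $2$.
   Context: Let $\Delta$ have dimension $d-1$. For a face $F$ of $\Delta$ (possibly empty), $\Gamma_F$ is the restriction of $\Gamma$ to $F$. The $h$-polynomial $h(\Gamma;x)=\sum_{i=0}^d h_ix^i$ is defined by $\sum_{i=0}^d h_i(x+1)^{d-i}=\sum_{i=0}^d f_{i-1}x^{d-i}$ with $f_{-1}=1$ and $f_i$ the number of $i$-faces of $\Gamma$ (the empty triangulation has $h=1$), and the local $h$-polynomial is $\ell(\Gamma;x)=\sum_{F\le \Delta}(-1)^{d-1-\dim F}h(\Gamma_F;x)$ over all faces of $\Delta$ including the empty one. A face $G$ of $\Gamma$ is carried by the smallest face $\sigma(G)$ of $\Delta$ containing it. The internal edge graph of $\Gamma$ is the graph whose edges are the edges of $\Gamma$ carried by $\Delta$ itself, and whose vertices are the vertices of $\Gamma$ incident to those edges. *)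

theory Defs
  imports "HOL-Analysis.Analysis" "HOL-Computational_Algebra.Polynomial"
begin

text \<open>A complex is the set of its (closed, convex) faces. As in the library notion
  \<^const>\<open>simplicial_complex\<close>, the empty face, of \<^const>\<open>aff_dim\<close> equal to \<open>-1\<close>,
  belongs to every nonempty complex.\<close>

definition geometric_triangulation :: "'a::euclidean_space set set \<Rightarrow> 'a set \<Rightarrow> bool" where
  "geometric_triangulation \<Gamma> \<Delta> \<longleftrightarrow> simplicial_complex \<Gamma> \<and> \<Union>\<Gamma> = \<Delta>"

definition restriction :: "'a set set \<Rightarrow> 'a set \<Rightarrow> 'a set set" where
  "restriction \<Gamma> F = {G \<in> \<Gamma>. G \<subseteq> F}"


subsection \<open>The \<open>h\<close>-polynomial and the local \<open>h\<close>-polynomial\<close>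

text \<open>\<open>num_faces \<Gamma> i\<close> is \<open>f\<^sub>i\<close>; the index is an integer because of \<open>f\<^sub>-\<^sub>1\<close>, which
  counts the empty face and hence is \<open>1\<close>.\<close>

definition num_faces :: "'a::euclidean_space set set \<Rightarrow> int \<Rightarrow> nat" where
  "num_faces \<Gamma> i = card {G \<in> \<Gamma>. aff_dim G = i}"

definition is_h_poly :: "nat \<Rightarrow> 'a::euclidean_space set set \<Rightarrow> int poly \<Rightarrow> bool" where
  "is_h_poly d \<Gamma> h \<longleftrightarrow> degree h \<le> d \<and>
     (\<Sum>i\<le>d. smult (coeff h i) ([:1, 1:] ^ (d - i))) =
     (\<Sum>i\<le>d. monom (int (num_faces \<Gamma> (int i - 1))) (d - i))"

text \<open>Here \<open>d - 1\<close> is the dimension of \<open>\<Gamma>\<close>. The description is justified by the lemma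
  \<open>ex1_h_poly\<close> below.\<close>

definition h_poly :: "nat \<Rightarrow> 'a::euclidean_space set set \<Rightarrow> int poly" where
  "h_poly d \<Gamma> = (THE h. is_h_poly d \<Gamma> h)"

text \<open>The faces \<open>F\<close> of the simplex \<open>\<Delta>\<close> include \<open>{}\<close> and \<open>\<Delta>\<close>. If \<open>dim \<Delta> = d - 1\<close>, the sign
  exponent is \<open>d - 1 - dim F\<close>; the triangulation \<open>\<Gamma>\<^sub>F\<close> of \<open>F\<close> has its own \<open>d\<close>, namely \<open>dim F + 1\<close>.\<close>

definition local_h_poly :: "'a::euclidean_space set set \<Rightarrow> 'a set \<Rightarrow> int poly" where
  "local_h_poly \<Gamma> \<Delta> =
     (\<Sum>F | F face_of \<Delta>. (-1) ^ nat (aff_dim \<Delta> - aff_dim F) *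
        h_poly (nat (aff_dim F + 1)) (restriction \<Gamma> F))"

lemma sum_reverse_atMost: "(\<Sum>i\<le>d. g i (d - i)) = (\<Sum>j\<le>d. g (d - j) j)" for d :: nat
  by (rule sum.reindex_bij_witness[where i = "\<lambda>j. d - j" and j = "\<lambda>j. d - j"]) auto

lemma pcompose_shift_inverse:
  fixes p :: "int poly"
  shows "pcompose (pcompose p [:-1, 1:]) [:1, 1:] = p"
    and "pcompose (pcompose p [:1, 1:]) [:-1, 1:] = p"
  by (simp_all add: pcompose_assoc[symmetric] pcompose_pCons pcompose_idR)

lemma h_sum_eq_pcompose:
  fixes h :: "int poly"
  shows "(\<Sum>i\<le>d. smult (coeff h i) ([:1, 1:] ^ (d - i))) =
         pcompose (\<Sum>i\<le>d. monom (coeff h i) (d - i)) [:1, 1:]"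
proof -
  have "pcompose (p ^ n) q = pcompose p q ^ n" for p q :: "int poly" and n
    by (induction n) (simp_all add: pcompose_mult pcompose_1)
  then show ?thesis
    by (simp add: pcompose_sum pcompose_smult monom_altdef pcompose_pCons)
qed

lemma ex1_h_poly: "\<exists>!h. is_h_poly d \<Gamma> h"
proof -
  define q :: "int poly"
    where "q = (\<Sum>i\<le>d. monom (int (num_faces \<Gamma> (int i - 1))) (d - i))"
  define r where "r = pcompose q [:-1, 1:]"
  have degq: "degree q \<le> d"
    unfolding q_def by (rule degree_sum_le) (auto intro: order.trans[OF degree_monom_le])
  have degr: "degree r \<le> d"
    unfolding r_def using degq by (simp add: degree_pcompose)
  have char: "is_h_poly d \<Gamma> h \<longleftrightarrow>
      degree h \<le> d \<and> (\<Sum>i\<le>d. monom (coeff h i) (d - i)) = r" for h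
    unfolding is_h_poly_def h_sum_eq_pcompose q_def[symmetric] r_def
    using pcompose_shift_inverse by metis
  have coeff_rev: "coeff (\<Sum>i\<le>d. monom (c i) (d - i)) j = (if j \<le> d then c (d - j) else 0)"
    for c :: "nat \<Rightarrow> int" and j
    unfolding sum_reverse_atMost[of "\<lambda>i k. monom (c i) k"]
    by (simp add: coeff_sum if_distrib cong: if_cong)
  have char2: "is_h_poly d \<Gamma> h \<longleftrightarrow> degree h \<le> d \<and> (\<forall>i\<le>d. coeff h i = coeff r (d - i))" for h
  proof -
    have "(\<Sum>i\<le>d. monom (coeff h i) (d - i)) = r \<longleftrightarrow>
        (\<forall>j. (if j \<le> d then coeff h (d - j) else 0) = coeff r j)"
      by (simp add: poly_eq_iff coeff_rev)
    also have "\<dots> \<longleftrightarrow> (\<forall>j\<le>d. coeff h (d - j) = coeff r j)"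
      using degr by (auto simp: coeff_eq_0)
    also have "\<dots> \<longleftrightarrow> (\<forall>i\<le>d. coeff h i = coeff r (d - i))"
      by (metis diff_diff_cancel diff_le_self)
    finally show ?thesis by (simp add: char)
  qed
  show ?thesis
  proof (rule ex1I)
    let ?h = "\<Sum>i\<le>d. monom (coeff r (d - i)) i"
    have c: "coeff ?h i = (if i \<le> d then coeff r (d - i) else 0)" for i
      by (simp add: coeff_sum)
    show "is_h_poly d \<Gamma> ?h"
      unfolding char2
      by (auto simp: c intro!: degree_le)
    show "h = ?h" if "is_h_poly d \<Gamma> h" for h
      using that unfolding char2 by (auto simp: poly_eq_iff c coeff_eq_0)
  qed
qed

lemma is_h_poly_h_poly: "is_h_poly d \<Gamma> (h_poly d \<Gamma>)"
  unfolding h_poly_def by (rule theI') (rule ex1_h_poly)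

lemma h_poly_empty_triangulation: "h_poly 0 {{} :: 'a::euclidean_space set} = 1"
proof -
  have "{G :: 'a set. G = {} \<and> aff_dim G = -1} = {{}}" by auto
  then have "num_faces {{} :: 'a set} (-1) = 1"
    by (simp add: num_faces_def)
  then have "is_h_poly 0 {{} :: 'a set} 1"
    by (simp add: is_h_poly_def monom_0 one_pCons)
  then show ?thesis using ex1_h_poly is_h_poly_h_poly by blast
qed


subsection \<open>Carriers and the internal edge graph\<close>

definition carrier_face :: "'a::euclidean_space set \<Rightarrow> 'a set \<Rightarrow> 'a set" where
  "carrier_face \<Delta> G = (LEAST F. F face_of \<Delta> \<and> G \<subseteq> F)"

lemma carrier_face_least:
  assumes "convex \<Delta>" "G \<subseteq> \<Delta>"
  shows "carrier_face \<Delta> G face_of \<Delta>" "G \<subseteq> carrier_face \<Delta> G"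
    and "F face_of \<Delta> \<Longrightarrow> G \<subseteq> F \<Longrightarrow> carrier_face \<Delta> G \<subseteq> F"
proof -
  let ?I = "\<Inter>{F. F face_of \<Delta> \<and> G \<subseteq> F}"
  have "\<Delta> \<in> {F. F face_of \<Delta> \<and> G \<subseteq> F}"
    using assms by (simp add: face_of_refl)
  then have "?I face_of \<Delta>"
    by (intro face_of_Inter) auto
  moreover have "carrier_face \<Delta> G = ?I"
    unfolding carrier_face_def by (rule Least_equality) (use calculation in auto)
  ultimately show "carrier_face \<Delta> G face_of \<Delta>" "G \<subseteq> carrier_face \<Delta> G"
    and "F face_of \<Delta> \<Longrightarrow> G \<subseteq> F \<Longrightarrow> carrier_face \<Delta> G \<subseteq> F"
    by auto
qed

text \<open>An edge of a graph is the set of its two endpoints; the corresponding face of \<open>\<Gamma>\<close> is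
  their convex hull.\<close>

definition internal_edges :: "'a::euclidean_space set set \<Rightarrow> 'a set \<Rightarrow> 'a set set" where
  "internal_edges \<Gamma> \<Delta> =
     {e. card e = 2 \<and> convex hull e \<in> \<Gamma> \<and> carrier_face \<Delta> (convex hull e) = \<Delta>}"

definition internal_vertices :: "'a::euclidean_space set set \<Rightarrow> 'a set \<Rightarrow> 'a set" where
  "internal_vertices \<Gamma> \<Delta> = {v. {v} \<in> \<Gamma> \<and> (\<exists>e\<in>internal_edges \<Gamma> \<Delta>. v \<in> e)}"

lemma internal_edges_subset_vertices:
  assumes "simplicial_complex \<Gamma>" "e \<in> internal_edges \<Gamma> \<Delta>"
  shows "e \<subseteq> internal_vertices \<Gamma> \<Delta>"
proof
  fix v assume v: "v \<in> e"
  have e: "card e = 2" "convex hull e \<in> \<Gamma>"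
    using assms(2) by (auto simp: internal_edges_def)
  then obtain a b where ab: "e = {a, b}" by (auto simp: card_2_iff)
  have "{v} face_of (convex hull e)"
    using v unfolding ab segment_convex_hull[symmetric]
    by (auto simp: face_of_singleton extreme_point_of_segment)
  then have "{v} \<in> \<Gamma>"
    using assms(1) e(2) unfolding simplicial_complex_def by blast
  then show "v \<in> internal_vertices \<Gamma> \<Delta>"
    using v assms(2) by (auto simp: internal_vertices_def)
qed


subsection \<open>Undirected simple graphs\<close>

text \<open>A graph is given by its vertex set \<open>V\<close> and a set \<open>E\<close> of two-element subsets of \<open>V\<close>.\<close>

definition connected_graph :: "'v set \<Rightarrow> 'v set set \<Rightarrow> bool" where
  "connected_graph V E \<longleftrightarrow> V \<noteq> {} \<and> (\<forall>u\<in>V. \<forall>v\<in>V. (\<lambda>x y. {x, y} \<in> E)\<^sup>*\<^sup>* u v)"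

definition is_cycle :: "'v set set \<Rightarrow> 'v list \<Rightarrow> bool" where
  "is_cycle E xs \<longleftrightarrow> length xs \<ge> 3 \<and> distinct xs \<and>
     (\<forall>i<length xs. {xs ! i, xs ! (Suc i mod length xs)} \<in> E)"

definition tree_graph :: "'v set \<Rightarrow> 'v set set \<Rightarrow> bool" where
  "tree_graph V E \<longleftrightarrow> connected_graph V E \<and> (\<nexists>xs. is_cycle E xs)"

definition induced_edges :: "'v set set \<Rightarrow> 'v set \<Rightarrow> 'v set set" where
  "induced_edges E W = {e \<in> E. e \<subseteq> W}"

definition graph_components :: "'v set \<Rightarrow> 'v set set \<Rightarrow> ('v set \<times> 'v set set) set" where
  "graph_components V E =
     {(W, induced_edges E W) | W. W \<subseteq> V \<and> connected_graph W (induced_edges E W) \<and>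
        (\<forall>W'. W \<subset> W' \<and> W' \<subseteq> V \<longrightarrow> \<not> connected_graph W' (induced_edges E W'))}"

end

theory Submission
  imports Defs
begin

text \<open>Let \<open>\<sigma>(G)\<close> be the set of vertices of the carrier of \<open>G\<close> and \<open>d = dim \<Delta> + 1\<close>.
  Inclusion-exclusion turns the local \<open>h\<close>-polynomial into the sum over the faces \<open>G\<close> of
  \<open>(-1) ^ (d - |\<sigma>(G)|) * x ^ (d - e) * (1 - x) ^ e\<close> with \<open>e = |\<sigma>(G)| - |G|\<close>. Hence \<open>\<ell>\<^sub>1\<close> counts
  the interior vertices and, if there are none, \<open>\<ell>\<^sub>2\<close> is the number of internal edges minus the
  number of facet vertices, i.e. vertices carried by facets. As every facet vertex lies on an
  internal edge and a connected graph has at least \<open>|V| - 1\<close> edges, it suffices that every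
  component contains a vertex carried in codimension at least two: then equality holds in every
  component.

  Suppose a component \<open>W\<close> consists of facet vertices only. If a top-dimensional simplex \<open>C\<close> meets
  \<open>W\<close>, its vertices outside \<open>W\<close> lie in all the facets carrying vertices of \<open>C \<inter> W\<close>, and there
  are at least two such facets. So no ridge of \<open>C\<close> avoids \<open>W\<close>; by connectedness through ridges
  every top-dimensional simplex meets \<open>W\<close>, and \<open>W\<close> contains all facet vertices and all internal
  edges. Around a simplex of dimension \<open>dim \<Delta> - 3\<close> in the intersection of three facets, walking
  through ridges yields a top-dimensional simplex with a vertex of \<open>W\<close> on each of these three
  facets, hence a triangle of internal edges. As \<open>\<Delta>\<close> has at least four facets, two distinct
  triangles arise, so the connected graph on \<open>W\<close> has more edges than vertices, contradicting
  \<open>\<ell>\<^sub>2 = 0\<close>.\<close>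

subsection \<open>Components of finite graphs\<close>

text \<open>Fix a root \<open>r\<close> and send every other vertex \<open>v\<close> to an edge
  towards a parent \<open>p v\<close> strictly closer to \<open>r\<close>. Two vertices sharing that
  edge would be parents of each other, each closer than the other, so the map is injective.\<close>

lemma connected_graph_card_le:
  assumes conn: "connected_graph W E" and fin: "finite E"
  shows "finite W" "card W \<le> card E + 1"
proof -
  let ?R = "\<lambda>x y. {x, y} \<in> E"
  obtain r where r: "r \<in> W" using conn by (auto simp: connected_graph_def)
  define dist where "dist v = (LEAST k. (?R ^^ k) r v)" for v
  have dist: "(?R ^^ dist v) r v" if "v \<in> W" for v
  proof -
    have "?R\<^sup>*\<^sup>* r v" using conn r that by (auto simp: connected_graph_def)
    then have "\<exists>k. (?R ^^ k) r v" by (simp add: rtranclp_power)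
    then show ?thesis unfolding dist_def by (rule LeastI_ex)
  qed
  have "\<exists>u. {v, u} \<in> E \<and> dist u < dist v" if "v \<in> W - {r}" for v
  proof -
    have d: "(?R ^^ dist v) r v" using that dist by auto
    have "dist v \<noteq> 0" using d that by (intro notI) auto
    then obtain k where k: "dist v = Suc k" using not0_implies_Suc by blast
    then obtain u where u: "(?R ^^ k) r u" "{u, v} \<in> E" using d by auto
    have "dist u \<le> k" unfolding dist_def by (rule Least_le) (rule u)
    then show ?thesis using u k by (auto simp: insert_commute)
  qed
  then obtain p where p: "\<And>v. v \<in> W - {r} \<Longrightarrow> {v, p v} \<in> E \<and> dist (p v) < dist v" by metis
  have inj: "inj_on (\<lambda>v. {v, p v}) (W - {r})"
  proof (rule inj_onI)
    fix u v assume "u \<in> W - {r}" "v \<in> W - {r}" "{u, p u} = {v, p v}"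
    then show "u = v" using p[of u] p[of v] by (fastforce simp: doubleton_eq_iff)
  qed
  have sub: "(\<lambda>v. {v, p v}) ` (W - {r}) \<subseteq> E" using p by auto
  have "finite (W - {r})" using inj_on_finite[OF inj sub fin] .
  then show finW: "finite W" by simp
  have "card (W - {r}) \<le> card E" using card_inj_on_le[OF inj sub fin] .
  then show "card W \<le> card E + 1" using finW r by simp
qed

text \<open>The given path serves as a detour, in either direction, wherever a walk used the deleted
  edge.\<close>

lemma connected_graph_remove_edge:
  assumes conn: "connected_graph W E" and path: "(\<lambda>x y. {x, y} \<in> E - {{a, b}})\<^sup>*\<^sup>* a b"
  shows "connected_graph W (E - {{a, b}})"
proof -
  let ?R = "\<lambda>x y. {x, y} \<in> E - {{a, b}}"
  have sym: "symp ?R" by (auto simp: symp_def insert_commute)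
  have "?R\<^sup>*\<^sup>* b a" using path sym by (metis sympD symp_rtranclp)
  then have step: "?R\<^sup>*\<^sup>* x y" if "{x, y} \<in> E" for x y
    using that path by (cases "{x, y} = {a, b}") (auto simp: doubleton_eq_iff)
  have "?R\<^sup>*\<^sup>* x y" if "(\<lambda>x y. {x, y} \<in> E)\<^sup>*\<^sup>* x y" for x y
    using that by (induction rule: rtranclp_induct) (use step in \<open>auto intro: rtranclp_trans\<close>)
  then show ?thesis using conn by (auto simp: connected_graph_def)
qed

lemma connected_graph_remove_triangle_edge:
  assumes "connected_graph W E" "{a, b} \<in> E" "{b, c} \<in> E" "{a, c} \<in> E" "distinct [a, b, c]"
  shows "connected_graph W (E - {{a, b}})"
proof (rule connected_graph_remove_edge[OF assms(1)])
  show "(\<lambda>x y. {x, y} \<in> E - {{a, b}})\<^sup>*\<^sup>* a b"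
    using assms
    by (intro converse_rtranclp_into_rtranclp[of _ a c] r_into_rtranclp)
      (auto simp: doubleton_eq_iff insert_commute)
qed

text \<open>The edge closing the cycle can be deleted, since the rest of the cycle joins its ends;
  the bound for connected graphs then applies to one edge fewer.\<close>

lemma connected_graph_cycle_card_le:
  assumes conn: "connected_graph W E" and fin: "finite E" and cyc: "is_cycle E xs"
  shows "card W \<le> card E"
proof -
  define m where "m = length xs - 1"
  have m: "length xs = Suc m" "m \<ge> 2" using cyc by (auto simp: is_cycle_def m_def)
  let ?e = "{xs ! 0, xs ! m}"
  have dist: "distinct xs" and ed: "\<And>i. i < length xs \<Longrightarrow> {xs ! i, xs ! (Suc i mod length xs)} \<in> E"
    using cyc by (auto simp: is_cycle_def)
  have e: "?e \<in> E" using ed[of m] m by (simp add: insert_commute)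
  have "(\<lambda>x y. {x, y} \<in> E - {?e})\<^sup>*\<^sup>* (xs ! 0) (xs ! k)" if "k \<le> m" for k
    using that
  proof (induction k)
    case (Suc k)
    have "{xs ! k, xs ! Suc k} \<in> E" using ed[of k] Suc.prems m by simp
    \<comment> \<open>Equality would force \<open>k = 0\<close> and \<open>m = 1\<close>, which the
      minimal cycle length 3 excludes.\<close>
    moreover have "{xs ! k, xs ! Suc k} \<noteq> ?e"
      using dist m Suc.prems by (auto simp: doubleton_eq_iff nth_eq_iff_index_eq)
    ultimately show ?case using Suc by (auto intro: rtranclp.rtrancl_into_rtrancl)
  qed simp
  from this[of m] have "connected_graph W (E - {?e})"
    by (intro connected_graph_remove_edge[OF conn]) simp
  then have "card W \<le> card (E - {?e}) + 1" using connected_graph_card_le fin by blast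
  also have "\<dots> = card E" using card_Suc_Diff1[OF fin e] by simp
  finally show ?thesis .
qed

text \<open>Some vertex of the first triangle is missing from the second. Deleting an edge at it
  leaves the second triangle intact, so a further edge can be deleted without disconnecting the
  graph. The cases only permute the first triangle.\<close>

lemma connected_graph_two_triangles_card_less:
  assumes conn: "connected_graph W E" and fin: "finite E"
    and t: "{a, b} \<in> E" "{b, c} \<in> E" "{a, c} \<in> E" "distinct [a, b, c]"
    and t': "{a', b'} \<in> E" "{b', c'} \<in> E" "{a', c'} \<in> E" "distinct [a', b', c']"
    and ne: "{a, b, c} \<noteq> {a', b', c'}"
  shows "card W < card E"
proof -
  have *: "card W < card E"
    if t: "{a, b} \<in> E" "{b, c} \<in> E" "{a, c} \<in> E" "distinct [a, b, c]"
      and x: "a \<notin> {a', b', c'}" for a b c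
  proof -
    have c1: "connected_graph W (E - {{a, b}})"
      by (rule connected_graph_remove_triangle_edge[OF conn t])
    have t2: "{a', b'} \<in> E - {{a, b}}" "{b', c'} \<in> E - {{a, b}}" "{a', c'} \<in> E - {{a, b}}"
      using t' x by (auto simp: doubleton_eq_iff)
    have "connected_graph W (E - {{a, b}} - {{a', b'}})"
      by (rule connected_graph_remove_triangle_edge[OF c1 t2 t'(4)])
    then have "card W \<le> card (E - {{a, b}} - {{a', b'}}) + 1"
      by (rule connected_graph_card_le) (use fin in simp)
    also have "\<dots> = card (E - {{a, b}})" using card_Suc_Diff1[OF _ t2(1)] fin by simp
    also have "\<dots> < card E" using t(1) fin by (meson card_Diff1_less)
    finally show ?thesis .
  qed
  have "card {a, b, c} = 3" "card {a', b', c'} = 3" using t t' by auto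
  then have "\<not> {a, b, c} \<subseteq> {a', b', c'}" using ne by (metis card_subset_eq finite.emptyI finite.insertI)
  then consider "a \<notin> {a', b', c'}" | "b \<notin> {a', b', c'}" | "c \<notin> {a', b', c'}" by blast
  then show ?thesis
  proof cases
    case 1 then show ?thesis using *[of a b c] t by blast
  next
    case 2 show ?thesis by (rule *[of b a c]) (use t 2 in \<open>auto simp: insert_commute\<close>)
  next
    case 3 show ?thesis by (rule *[of c a b]) (use t 3 in \<open>auto simp: insert_commute\<close>)
  qed
qed

section \<open>Reachability classes and components\<close>

definition graph_class :: "'v set set \<Rightarrow> 'v \<Rightarrow> 'v set" where
  "graph_class E v = {w. (\<lambda>x y. {x, y} \<in> E)\<^sup>*\<^sup>* v w}"

lemma graph_class_refl [simp]: "v \<in> graph_class E v"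
  by (simp add: graph_class_def)

lemma graph_class_eq:
  assumes "w \<in> graph_class E v" shows "graph_class E w = graph_class E v"
proof -
  have s: "symp (\<lambda>x y. {x, y} \<in> E)" by (auto simp: symp_def insert_commute)
  then have "(\<lambda>x y. {x, y} \<in> E)\<^sup>*\<^sup>* w v"
    using assms unfolding graph_class_def by (metis mem_Collect_eq sympD symp_rtranclp)
  then show ?thesis using assms unfolding graph_class_def by (auto intro: rtranclp_trans)
qed

lemma graph_class_edge:
  assumes "{x, y} \<in> E" "x \<in> graph_class E v" shows "y \<in> graph_class E v"
  using assms unfolding graph_class_def by (auto intro: rtranclp.rtrancl_into_rtrancl)

lemma graph_class_subset:
  assumes "\<Union>E \<subseteq> V" "v \<in> V" shows "graph_class E v \<subseteq> V"
proof
  fix w assume "w \<in> graph_class E v"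
  then have "(\<lambda>x y. {x, y} \<in> E)\<^sup>*\<^sup>* v w" by (simp add: graph_class_def)
  then show "w \<in> V" by (induction rule: rtranclp_induct) (use assms in auto)
qed

lemma connected_graph_class: "connected_graph (graph_class E v) (induced_edges E (graph_class E v))"
proof -
  let ?R = "\<lambda>x y. {x, y} \<in> induced_edges E (graph_class E v)"
  have "?R\<^sup>*\<^sup>* u w" if u: "u \<in> graph_class E v" and w: "w \<in> graph_class E v" for u w
  proof -
    have uw: "(\<lambda>x y. {x, y} \<in> E)\<^sup>*\<^sup>* u w"
      using graph_class_eq[OF u] w by (auto simp: graph_class_def)
    have "?R\<^sup>*\<^sup>* u w \<and> w \<in> graph_class E v"
      using uw
    proof (induction rule: rtranclp_induct)
      case base then show ?case using u by simp
    next
      case (step y z)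
      then have z: "z \<in> graph_class E v" using graph_class_edge by metis
      then have "?R y z" using step by (auto simp: induced_edges_def)
      then show ?case using step z by (meson rtranclp.rtrancl_into_rtrancl)
    qed
    then show ?thesis by simp
  qed
  then show ?thesis unfolding connected_graph_def by (auto intro: graph_class_refl)
qed

text \<open>The reachability class of any vertex of \<open>W\<close> contains \<open>W\<close> and
  is itself connected, so maximality of \<open>W\<close> makes them equal.\<close>

lemma graph_componentsE:
  assumes "(W, F) \<in> graph_components V E" "\<Union>E \<subseteq> V"
  obtains v where "v \<in> V" "W = graph_class E v" "F = induced_edges E W"
proof -
  have "W \<subseteq> V \<and> connected_graph W (induced_edges E W) \<and> F = induced_edges E W \<and>
      (\<forall>W'. W \<subset> W' \<and> W' \<subseteq> V \<longrightarrow> \<not> connected_graph W' (induced_edges E W'))"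
    using assms(1) by (simp add: graph_components_def)
  then have W: "W \<subseteq> V" "connected_graph W (induced_edges E W)" "F = induced_edges E W"
    and max: "\<And>W'. W \<subset> W' \<Longrightarrow> W' \<subseteq> V \<Longrightarrow> \<not> connected_graph W' (induced_edges E W')"
    by simp_all
  obtain v where v: "v \<in> W" using W(2) unfolding connected_graph_def by blast
  have "W \<subseteq> graph_class E v"
  proof
    fix w assume "w \<in> W"
    then have "(\<lambda>x y. {x, y} \<in> induced_edges E W)\<^sup>*\<^sup>* v w"
      using W(2) v unfolding connected_graph_def by blast
    then have "(\<lambda>x y. {x, y} \<in> E)\<^sup>*\<^sup>* v w"
      by (induction rule: rtranclp_induct)
        (auto simp: induced_edges_def intro: rtranclp.rtrancl_into_rtrancl)
    then show "w \<in> graph_class E v" by (simp add: graph_class_def)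
  qed
  moreover have "graph_class E v \<subseteq> V" using graph_class_subset[OF assms(2)] v W(1) by blast
  ultimately have "W = graph_class E v"
    using max[of "graph_class E v"] connected_graph_class[of E v] by blast
  moreover have "v \<in> V" using v W(1) by blast
  ultimately show ?thesis using W(3) by (intro that)
qed

text \<open>Each component \<open>W\<close> has at least \<open>card W - 1\<close> edges, so it has at least as many edges as
  vertices in \<open>A\<close>; equality of the totals forces equality in each component.\<close>

lemma graph_components_tree_unique:
  assumes fin: "finite V" and E: "\<And>e. e \<in> E \<Longrightarrow> card e = 2 \<and> e \<subseteq> V"
    and A: "A \<subseteq> V" and card: "card E = card A"
    and ex: "\<And>v. v \<in> V \<Longrightarrow> \<exists>w\<in>graph_class E v. w \<notin> A"
    and comp: "(W, F) \<in> graph_components V E"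
  shows "tree_graph W F \<and> (\<exists>!v. v \<in> W \<and> v \<notin> A)"
proof -
  have EV: "\<Union>E \<subseteq> V" using E by blast
  have finE: "finite E" using fin EV by (meson finite_UnionD finite_subset)
  define \<C> where "\<C> = graph_class E ` V"
  have cV: "c \<subseteq> V" if "c \<in> \<C>" for c using that graph_class_subset[OF EV] by (auto simp: \<C>_def)
  have finC: "finite \<C>" using fin by (simp add: \<C>_def)
  have fc: "finite c" if "c \<in> \<C>" for c using cV[OF that] fin finite_subset by blast
  have disj: "c = c'" if "c \<in> \<C>" "c' \<in> \<C>" "x \<in> c" "x \<in> c'" for c c' x
    using that graph_class_eq unfolding \<C>_def by (metis imageE)
  have E_un: "E = (\<Union>c\<in>\<C>. induced_edges E c)"
  proof (intro equalityI subsetI)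
    fix e assume e: "e \<in> E"
    then obtain a b where ab: "e = {a, b}" using E by (meson card_2_iff)
    then have "a \<in> V" using E[OF e] by auto
    moreover have "e \<subseteq> graph_class E a" using ab e graph_class_edge[of a b E a] by auto
    ultimately show "e \<in> (\<Union>c\<in>\<C>. induced_edges E c)" using e by (auto simp: \<C>_def induced_edges_def)
  qed (auto simp: induced_edges_def)
  have E_disj: "induced_edges E c \<inter> induced_edges E c' = {}" if "c \<in> \<C>" "c' \<in> \<C>" "c \<noteq> c'" for c c'
  proof (rule ccontr)
    assume "\<not> ?thesis"
    then obtain e where e: "e \<in> E" "e \<subseteq> c" "e \<subseteq> c'" by (auto simp: induced_edges_def)
    then obtain x where "x \<in> e" using E[OF e(1)] by (metis card.empty all_not_in_conv zero_neq_numeral)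
    then show False using disj that e by blast
  qed
  have finI: "finite (induced_edges E c)" for c using finE by (simp add: induced_edges_def)
  have "card (\<Union>c\<in>\<C>. induced_edges E c) = (\<Sum>c\<in>\<C>. card (induced_edges E c))"
    by (rule card_UN_disjoint) (use finC finI E_disj in blast)+
  then have cardE: "card E = (\<Sum>c\<in>\<C>. card (induced_edges E c))"
    using E_un by simp
  have A_un: "A = (\<Union>c\<in>\<C>. A \<inter> c)" using A unfolding \<C>_def by (auto intro: graph_class_refl)
  have "card (\<Union>c\<in>\<C>. A \<inter> c) = (\<Sum>c\<in>\<C>. card (A \<inter> c))"
    by (rule card_UN_disjoint) (use finC fc disj in blast)+
  then have cardA: "card A = (\<Sum>c\<in>\<C>. card (A \<inter> c))"
    using A_un by simp
  have conn: "connected_graph c (induced_edges E c)" if "c \<in> \<C>" for c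
    using that connected_graph_class by (auto simp: \<C>_def)
  have out: "card (c - A) \<ge> 1" if "c \<in> \<C>" for c
  proof -
    have "c - A \<noteq> {}" using that ex by (auto simp: \<C>_def)
    then show ?thesis using fc[OF that] by (simp add: Suc_le_eq card_gt_0_iff)
  qed
  have split: "card c = card (A \<inter> c) + card (c - A)" if "c \<in> \<C>" for c
    using fc[OF that] by (metis Int_commute card_Int_Diff)
  have le: "card (A \<inter> c) \<le> card (induced_edges E c)" if "c \<in> \<C>" for c
    using connected_graph_card_le(2)[OF conn[OF that] finI] out[OF that] split[OF that] by linarith
  have eq: "card (A \<inter> c) = card (induced_edges E c)" if c: "c \<in> \<C>" for c
  proof (rule ccontr)
    assume "\<not> ?thesis"
    then have "(\<Sum>c\<in>\<C>. card (A \<inter> c)) < (\<Sum>c\<in>\<C>. card (induced_edges E c))"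
      using le c finC order.not_eq_order_implies_strict by (intro sum_strict_mono_ex1) blast+
    then show False using card cardE cardA by simp
  qed
  obtain v where v: "v \<in> V" "W = graph_class E v" "F = induced_edges E W"
    using graph_componentsE[OF comp EV] .
  then have W: "W \<in> \<C>" by (auto simp: \<C>_def)
  \<comment> \<open>\<open>W\<close> has as many edges as vertices in \<open>A\<close>, and some
    vertex outside \<open>A\<close>, hence fewer edges than vertices; a cycle would give at least as
    many.\<close>
  have "\<not> is_cycle F xs" for xs
    using connected_graph_cycle_card_le[OF conn[OF W] finI, of xs] eq[OF W] out[OF W] split[OF W] v(3)
    by auto
  moreover have "card (W - A) = 1"
    using connected_graph_card_le(2)[OF conn[OF W] finI] eq[OF W] out[OF W] split[OF W] by linarith
  then obtain x where "W - A = {x}" by (auto simp: card_1_singleton_iff)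
  then have "v \<in> W \<and> v \<notin> A \<longleftrightarrow> v = x" for v by (metis Diff_iff singleton_iff)
  then have "\<exists>!v. v \<in> W \<and> v \<notin> A" by simp
  ultimately show ?thesis using conn[OF W] v(3) by (auto simp: tree_graph_def)
qed

subsection \<open>The combinatorial core\<close>

text \<open>Abstract data of a triangulated \<open>n\<close>-simplex without interior vertices: \<open>N\<close> consists of the
  vertex sets of the \<open>n\<close>-simplices, \<open>D\<close> indexes the facets, and \<open>I v\<close> is the set of facets
  containing \<open>v\<close>, so that the carrier of \<open>v\<close> has codimension \<open>card (I v)\<close>.\<close>

locale facet_labelled_complex =
  fixes D :: "'i set" and N :: "'v set set" and I :: "'v \<Rightarrow> 'i set" and n :: nat
  assumes card_D: "card D = n + 1" and n_ge: "n \<ge> 3"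
    and fin_N: "finite N" and N_ne: "N \<noteq> {}"
    and card_C: "C \<in> N \<Longrightarrow> card C = n + 1"
    and I_sub: "v \<in> \<Union>N \<Longrightarrow> I v \<subseteq> D" and I_ne: "v \<in> \<Union>N \<Longrightarrow> I v \<noteq> {}"
    and bound: "\<lbrakk>C \<in> N; S \<subseteq> C; J \<subseteq> D; \<And>v. v \<in> S \<Longrightarrow> J \<subseteq> I v\<rbrakk> \<Longrightarrow> card S + card J \<le> n + 1"
    and ridge_connected: "\<lbrakk>C \<in> N; C' \<in> N; \<tau> \<subseteq> C; \<tau> \<subseteq> C'; P C;
      \<And>A B. \<lbrakk>A \<in> N; B \<in> N; P A; \<tau> \<subseteq> A \<inter> B; card (A \<inter> B) = n;
        \<And>c. c \<in> D \<Longrightarrow> \<exists>v\<in>A \<inter> B. c \<notin> I v\<rbrakk> \<Longrightarrow> P B\<rbrakk> \<Longrightarrow> P C'"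
    and deep_face: "\<lbrakk>T \<subseteq> D; card T \<le> n\<rbrakk> \<Longrightarrow>
      \<exists>\<tau>. card \<tau> + card T = n + 1 \<and> (\<exists>C\<in>N. \<tau> \<subseteq> C) \<and> (\<forall>v\<in>\<tau>. T \<subseteq> I v)"
    and boundary_ridge: "\<lbrakk>C \<in> N; \<tau> \<subseteq> C; \<tau> \<noteq> {}; a \<in> D; \<And>v. v \<in> \<tau> \<Longrightarrow> a \<in> I v\<rbrakk> \<Longrightarrow>
      \<exists>C'\<in>N. \<tau> \<subseteq> C' \<and> n \<le> card {v \<in> C'. a \<in> I v}"
begin

text \<open>Disjointness of the two label sets says that no facet contains both ends, that is, that
  the edge is carried by the whole simplex.\<close>

definition edges :: "'v set set" where
  "edges = {{a, b} | a b. a \<noteq> b \<and> I a \<inter> I b = {} \<and> (\<exists>C\<in>N. {a, b} \<subseteq> C)}"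

lemma edgesI: "C \<in> N \<Longrightarrow> a \<in> C \<Longrightarrow> b \<in> C \<Longrightarrow> I a \<inter> I b = {} \<Longrightarrow> {a, b} \<in> edges"
  using I_ne[of a] unfolding edges_def by blast

lemma edges_sub: "\<Union>edges \<subseteq> \<Union>N"
  by (auto simp: edges_def)

lemma fin_D: "finite D"
  using card_D by (intro card_ge_0_finite) simp

lemma fin_C: "C \<in> N \<Longrightarrow> finite C"
  using card_C by (intro card_ge_0_finite) simp

lemma fin_edges: "finite edges"
proof -
  have "finite (\<Union>N)" using fin_N fin_C by blast
  moreover have "edges \<subseteq> Pow (\<Union>N)" using edges_sub by blast
  ultimately show ?thesis by (meson finite_Pow_iff finite_subset)
qed

text \<open>By \<open>bound\<close>, a top-dimensional simplex at \<open>v\<close> does not lie in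
  facet \<open>i\<close>; any vertex of it off that facet is joined to \<open>v\<close> by an
  edge.\<close>

lemma facet_vertex_in_edge:
  assumes "v \<in> \<Union>N" "I v = {i}"
  shows "v \<in> \<Union>edges"
proof -
  obtain C where C: "C \<in> N" "v \<in> C" using assms by blast
  have "\<exists>u\<in>C. i \<notin> I u"
  proof (rule ccontr)
    assume "\<not> ?thesis"
    moreover have "{i} \<subseteq> D" using I_sub[OF assms(1)] assms(2) by simp
    ultimately have "card C + card {i} \<le> n + 1"
      using bound[OF C(1) order_refl, of "{i}"] by blast
    then show False using card_C[OF C(1)] by simp
  qed
  then obtain u where u: "u \<in> C" "i \<notin> I u" by blast
  have "{v, u} \<in> edges" using C u assms by (intro edgesI) auto
  then show ?thesis by blast
qed

end

text \<open>The situation to be refuted: a component \<open>W\<close> of the edge graph all of whose vertices are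
  carried by facets.\<close>

locale facet_class = facet_labelled_complex +
  fixes W
  assumes W_sub: "W \<subseteq> \<Union>N"
    and W_closed: "\<And>x y. {x, y} \<in> edges \<Longrightarrow> x \<in> W \<Longrightarrow> y \<in> W"
    and W_ne: "W \<noteq> {}"
    and W_facet: "\<And>w. w \<in> W \<Longrightarrow> card (I w) = 1"
begin

definition labels :: "'b set \<Rightarrow> 'a set" where
  "labels C = \<Union>(I ` (C \<inter> W))"

lemma labels_sub: "C \<in> N \<Longrightarrow> labels C \<subseteq> D"
  using I_sub by (force simp: labels_def)

lemma fin_labels: "C \<in> N \<Longrightarrow> finite (labels C)"
  using labels_sub fin_D finite_subset by blast

text \<open>A vertex \<open>w\<close> of \<open>C\<close> in \<open>W\<close> has a single label. If
  \<open>u\<close> lacked it, \<open>{w, u}\<close> would be an edge and closedness would put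
  \<open>u\<close> into \<open>W\<close>.\<close>

lemma labels_le:
  assumes "C \<in> N" "u \<in> C" "u \<notin> W"
  shows "labels C \<subseteq> I u"
proof -
  have "I w \<subseteq> I u" if w: "w \<in> C \<inter> W" for w
  proof (rule ccontr)
    assume *: "\<not> I w \<subseteq> I u"
    obtain i where "I w = {i}" using W_facet w by (auto simp: card_1_singleton_iff)
    then have "{w, u} \<in> edges" using assms w * by (intro edgesI) auto
    then show False using W_closed w assms(3) by blast
  qed
  then show ?thesis by (auto simp: labels_def)
qed

text \<open>The vertices of \<open>C\<close> outside \<open>W\<close> all lie in the common face of
  the facets in \<open>labels C\<close>, so \<open>bound\<close> applies.\<close>

lemma card_outside_le:
  assumes "C \<in> N" shows "card (C - W) + card (labels C) \<le> n + 1"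
  using labels_le[OF assms] by (intro bound[OF assms]) (use labels_sub[OF assms] in auto)

text \<open>With a single label \<open>i\<close>, every vertex of \<open>C\<close>, in
  \<open>W\<close> or not, would lie in facet \<open>i\<close>, contradicting
  \<open>bound\<close>.\<close>

lemma card_labels_ge:
  assumes C: "C \<in> N" and ne: "C \<inter> W \<noteq> {}"
  shows "card (labels C) \<ge> 2"
proof (rule ccontr)
  assume "\<not> ?thesis"
  moreover obtain w where w: "w \<in> C" "w \<in> W" using ne by blast
  then have "labels C \<noteq> {}" using I_ne[of w] C by (auto simp: labels_def)
  then have "card (labels C) \<noteq> 0" using fin_labels[OF C] by simp
  ultimately have "card (labels C) = 1" by linarith
  then obtain i where i: "labels C = {i}" by (auto simp: card_1_singleton_iff)
  have "{i} \<subseteq> I u" if u: "u \<in> C" for u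
  proof (cases "u \<in> W")
    case True
    then have "I u \<subseteq> {i}" using u i by (auto simp: labels_def)
    then show ?thesis using I_ne[of u] u C by blast
  next
    case False then show ?thesis using labels_le[OF C u] i by simp
  qed
  then have "card C + card {i} \<le> n + 1"
    using bound[OF C order_refl, of "{i}"] labels_sub[OF C] i by simp
  then show False using card_C[OF C] by simp
qed

text \<open>If \<open>A\<close> meets \<open>W\<close>, at most \<open>n - 1\<close> of its vertices
  lie outside \<open>W\<close>, so each ridge of \<open>A\<close>, having \<open>n\<close> vertices,
  passes a vertex of \<open>W\<close> on to its neighbour.\<close>

lemma meets_W:
  assumes C: "C \<in> N" shows "C \<inter> W \<noteq> {}"
proof -
  obtain C0 where C0: "C0 \<in> N" "C0 \<inter> W \<noteq> {}" using W_ne W_sub by blast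
  show ?thesis
  proof (rule ridge_connected[of C0 C "{}" "\<lambda>C. C \<inter> W \<noteq> {}"])
    fix A B assume A: "A \<in> N" "B \<in> N" "A \<inter> W \<noteq> {}" "card (A \<inter> B) = n"
    show "B \<inter> W \<noteq> {}"
    proof
      assume "B \<inter> W = {}"
      then have "card (A \<inter> B) \<le> card (A - W)"
        using fin_C[OF A(1)] by (intro card_mono) auto
      then show False
        using card_outside_le[OF A(1)] card_labels_ge[OF A(1,3)] A(4) by linarith
    qed
  qed (use C C0 in auto)
qed

text \<open>A vertex outside \<open>W\<close> inherits all labels of a top-dimensional simplex
  containing it, hence lies in at least two facets.\<close>

lemma facet_vertices_eq: "{v \<in> \<Union>N. card (I v) = 1} = W"
proof
  show "{v \<in> \<Union>N. card (I v) = 1} \<subseteq> W"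
  proof
    fix v assume v: "v \<in> {v \<in> \<Union>N. card (I v) = 1}"
    then obtain C where C: "C \<in> N" "v \<in> C" by blast
    show "v \<in> W"
    proof (rule ccontr)
      assume "v \<notin> W"
      then have "labels C \<subseteq> I v" using labels_le C by blast
      moreover have "finite (I v)" using v by (intro card_ge_0_finite) simp
      ultimately have "card (labels C) \<le> 1" using card_mono v by fastforce
      then show False using card_labels_ge[OF C(1) meets_W[OF C(1)]] by simp
    qed
  qed
qed (use W_sub W_facet in auto)

text \<open>Two ends outside \<open>W\<close> would share the nonempty set \<open>labels C\<close>;
  so one end lies in \<open>W\<close>, and closedness adds the other.\<close>

lemma edges_W: "e \<in> edges \<Longrightarrow> e \<subseteq> W"
proof -
  assume "e \<in> edges"
  then obtain a b C where e: "e = {a, b}" "I a \<inter> I b = {}" "C \<in> N" "a \<in> C" "b \<in> C"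
    unfolding edges_def by blast
  have "a \<in> W \<or> b \<in> W"
  proof (rule ccontr)
    assume "\<not> ?thesis"
    then have "labels C \<subseteq> {}" using labels_le[of C a] labels_le[of C b] e by auto
    then show False using card_labels_ge[OF e(3) meets_W[OF e(3)]] by simp
  qed
  then show "e \<subseteq> W" using W_closed[of a b] W_closed[of b a] e(1) \<open>e \<in> edges\<close> by (auto simp: insert_commute)
qed

text \<open>Otherwise, around a simplex \<tau> with \<open>n - 2\<close> vertices in the
  intersection of the three facets, every top-dimensional simplex carries exactly two labels from
  \<open>T\<close>. That pair is the same all around \<tau>, which fails at a ridge in the third
  facet.\<close>

lemma ex_full_labels:
  assumes T: "T \<subseteq> D" "card T = 3"
  shows "\<exists>C\<in>N. labels C = T"
proof (rule ccontr)
  assume no: "\<not> ?thesis"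
  have finT: "finite T" using T(1) fin_D finite_subset by blast
  obtain \<tau> C0 where \<tau>: "card \<tau> + 3 = n + 1" "C0 \<in> N" "\<tau> \<subseteq> C0" "\<And>v. v \<in> \<tau> \<Longrightarrow> T \<subseteq> I v"
    using deep_face[OF T(1)] T(2) n_ge by auto
  have fin\<tau>: "finite \<tau>" using \<tau>(2,3) fin_C finite_subset by blast
  have ne: "\<tau> \<noteq> {}" using \<tau>(1) n_ge by auto
  have \<tau>W: "v \<notin> W" if "v \<in> \<tau>" for v
  proof
    assume "v \<in> W"
    then have "card (I v) = 1" using W_facet by simp
    moreover have "finite (I v)" using I_sub[of v] that \<tau>(2,3) fin_D finite_subset by blast
    ultimately show False using card_mono[of "I v" T] \<tau>(4)[OF that] T(2) by simp
  qed
  \<comment> \<open>A label outside \<open>T\<close> would place \<tau> in four facets, too many for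
    its \<open>n - 2\<close> vertices.\<close>
  have lab: "labels C \<subseteq> T" if C: "C \<in> N" "\<tau> \<subseteq> C" for C
  proof -
    have "T \<union> labels C \<subseteq> I v" if "v \<in> \<tau>" for v
      using labels_le[OF C(1)] \<tau>W[OF that] that C(2) \<tau>(4)[OF that] by blast
    then have "card \<tau> + card (T \<union> labels C) \<le> n + 1"
      using T(1) labels_sub[OF C(1)] by (intro bound[OF C]) auto
    then have "card (T \<union> labels C) \<le> card T" using \<tau>(1) T(2) by simp
    then have "T = T \<union> labels C" using finT fin_labels[OF C(1)] by (intro card_seteq) auto
    then show ?thesis by blast
  qed
  have lab2: "card (labels C) = 2" if C: "C \<in> N" "\<tau> \<subseteq> C" for C
  proof -
    have "labels C \<subset> T" using lab[OF C] no C(1) by blast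
    then have "card (labels C) < 3" using psubset_card_mono[OF finT] T(2) by metis
    then show ?thesis using card_labels_ge[OF C(1) meets_W[OF C(1)]] by simp
  qed
  \<comment> \<open>Two different pairs in \<open>T\<close> share exactly one label
    \<open>c\<close>. Ridge vertices in \<open>W\<close> can only have label \<open>c\<close>, and
    those outside \<open>W\<close> lie in all facets of \<open>T\<close>; so the ridge would lie in
    facet \<open>c\<close>, although it is interior.\<close>
  have const: "labels C = labels C0" if C: "C \<in> N" "\<tau> \<subseteq> C" for C
  proof (rule ridge_connected[OF \<tau>(2) C(1) \<tau>(3) C(2), of "\<lambda>C. labels C = labels C0"])
    fix A B
    assume A: "A \<in> N" and B: "B \<in> N" and eq: "labels A = labels C0" and sub: "\<tau> \<subseteq> A \<inter> B"
      and card: "card (A \<inter> B) = n" and int: "\<And>c. c \<in> D \<Longrightarrow> \<exists>v\<in>A \<inter> B. c \<notin> I v"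
    have \<tau>A: "\<tau> \<subseteq> A" and \<tau>B: "\<tau> \<subseteq> B" using sub by auto
    show "labels B = labels C0"
    proof (rule ccontr)
      assume "labels B \<noteq> labels C0"
      then have neq: "labels A \<noteq> labels B" using eq by simp
      have "card (labels A \<union> labels B) > 2"
      proof (rule ccontr)
        assume "\<not> ?thesis"
        then have "labels A = labels A \<union> labels B" "labels B = labels A \<union> labels B"
          using lab2[OF A \<tau>A] lab2[OF B \<tau>B] fin_labels[OF A] fin_labels[OF B]
          by (intro card_seteq; simp)+
        then show False using neq by simp
      qed
      then have TU: "labels A \<union> labels B = T"
        using lab[OF A \<tau>A] lab[OF B \<tau>B] finT T(2) by (intro card_seteq) auto
      then have "card (labels A \<inter> labels B) = 1"
        using card_Un_Int[OF fin_labels[OF A] fin_labels[OF B]] lab2[OF A \<tau>A] lab2[OF B \<tau>B] T(2)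
        by simp
      then obtain c where c: "labels A \<inter> labels B = {c}" by (auto simp: card_1_singleton_iff)
      have "c \<in> I v" if v: "v \<in> A \<inter> B" for v
      proof (cases "v \<in> W")
        case True
        then have "I v \<subseteq> {c}" using v unfolding c[symmetric] by (auto simp: labels_def)
        then show ?thesis using I_ne[of v] v A by blast
      next
        case False
        have "T \<subseteq> I v" using labels_le[OF A _ False] labels_le[OF B _ False] v TU by blast
        then show ?thesis using c TU by blast
      qed
      moreover have "c \<in> D" using c labels_sub[OF A] by blast
      ultimately show False using int by blast
    qed
  qed simp
  have "labels C0 \<subset> T" using lab[OF \<tau>(2,3)] no \<tau>(2) by blast
  \<comment> \<open>\<open>a\<close> is the third facet. It contains \<open>n\<close> vertices of
    some top-dimensional simplex around \<tau>; as \<open>a\<close> is not a label, these avoid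
    \<open>W\<close>, but at most \<open>n - 1\<close> vertices do.\<close>
  then obtain a where a: "a \<in> T" "a \<notin> labels C0" by blast
  then obtain C where C: "C \<in> N" "\<tau> \<subseteq> C" "n \<le> card {v \<in> C. a \<in> I v}"
    using boundary_ridge[OF \<tau>(2,3) ne, of a] T(1) \<tau>(4) by blast
  have "{v \<in> C. a \<in> I v} \<subseteq> C - W" using a(2) const[OF C(1,2)] by (auto simp: labels_def)
  then have "card {v \<in> C. a \<in> I v} \<le> card (C - W)" using fin_C[OF C(1)] by (intro card_mono) auto
  then show False using C(3) card_outside_le[OF C(1)] lab2[OF C(1,2)] by linarith
qed

text \<open>Vertices of \<open>W\<close> with different single labels in one simplex are joined by
  edges. The union of the labels is recorded in order to tell triangles for different
  \<open>T\<close> apart.\<close>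

lemma ex_labelled_triangle:
  assumes T: "T \<subseteq> D" "card T = 3"
  obtains a b c where "{a, b} \<in> edges" "{b, c} \<in> edges" "{a, c} \<in> edges" "distinct [a, b, c]"
    "\<Union>(I ` {a, b, c}) = T"
proof -
  obtain C where C: "C \<in> N" "labels C = T" using ex_full_labels[OF T] by blast
  obtain x y z where xyz: "T = {x, y, z}" "distinct [x, y, z]"
    using T(2) by (auto simp: card_3_iff)
  have "\<exists>w\<in>C. I w = {i}" if i: "i \<in> T" for i
  proof -
    obtain w where w: "w \<in> C \<inter> W" "i \<in> I w" using i C(2) unfolding labels_def by blast
    then have "I w = {i}" using W_facet[of w] by (auto simp: card_1_singleton_iff)
    then show ?thesis using w by blast
  qed
  then obtain a b c where abc: "a \<in> C" "b \<in> C" "c \<in> C" "I a = {x}" "I b = {y}" "I c = {z}"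
    using xyz by (metis insertCI)
  show ?thesis
    by (rule that[of a b c]) (use abc xyz C in \<open>auto intro!: edgesI\<close>)
qed

lemma card_facet_vertices_less:
  assumes conn: "connected_graph W edges"
  shows "card {v \<in> \<Union>N. card (I v) = 1} < card edges"
proof -
  obtain T where T: "T \<subseteq> D" "card T = 3"
    using obtain_subset_with_card_n[of 3 D] card_D n_ge by auto
  have "\<not> D \<subseteq> T" using card_mono[of T D] T fin_D finite_subset[OF T(1)] card_D n_ge by auto
  then obtain y where y: "y \<in> D" "y \<notin> T" by blast
  obtain x where x: "x \<in> T" using T(2) by fastforce
  \<comment> \<open>Since \<open>D\<close> has at least four elements, exchanging one gives a second
    triple and so a second triangle.\<close>
  have T': "insert y (T - {x}) \<subseteq> D" "card (insert y (T - {x})) = 3"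
    using T x y finite_subset[OF T(1) fin_D] by auto
  obtain a b c where t: "{a, b} \<in> edges" "{b, c} \<in> edges" "{a, c} \<in> edges" "distinct [a, b, c]"
    "\<Union>(I ` {a, b, c}) = T" using ex_labelled_triangle[OF T] .
  obtain a' b' c' where t': "{a', b'} \<in> edges" "{b', c'} \<in> edges" "{a', c'} \<in> edges"
    "distinct [a', b', c']" "\<Union>(I ` {a', b', c'}) = insert y (T - {x})"
    using ex_labelled_triangle[OF T'] .
  have "{a, b, c} \<noteq> {a', b', c'}" using t(5) t'(5) y(2) by (metis insertI1)
  then have "card W < card edges"
    using connected_graph_two_triangles_card_less[OF conn fin_edges t(1-4) t'(1-4)] by blast
  then show ?thesis using facet_vertices_eq by simp
qed

end

context facet_labelled_complex begin

text \<open>A class made of facet vertices only would absorb all edges and all facet vertices; being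
  connected with two distinct triangles, it has more edges than vertices, against the assumed
  equality.\<close>

lemma ex_deep_vertex_in_class:
  assumes v: "v \<in> \<Union>N" and card: "card edges = card {v \<in> \<Union>N. card (I v) = 1}"
  shows "\<exists>w\<in>graph_class edges v. card (I w) \<noteq> 1"
proof (rule ccontr)
  assume no: "\<not> ?thesis"
  interpret facet_class D N I n "graph_class edges v"
  proof
    show "graph_class edges v \<subseteq> \<Union>N" using graph_class_subset[OF edges_sub v] .
    show "\<And>x y. {x, y} \<in> edges \<Longrightarrow> x \<in> graph_class edges v \<Longrightarrow> y \<in> graph_class edges v"
      by (rule graph_class_edge)
    show "graph_class edges v \<noteq> {}" using graph_class_refl[of v edges] by blast
    show "\<And>w. w \<in> graph_class edges v \<Longrightarrow> card (I w) = 1" using no by blast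
  qed
  have "induced_edges edges (graph_class edges v) = edges"
    using edges_W by (auto simp: induced_edges_def)
  then have "connected_graph (graph_class edges v) edges" using connected_graph_class[of edges v] by simp
  from card_facet_vertices_less[OF this] card show False by simp
qed

end

subsection \<open>Purity and ridge-connectedness of geometric triangulations\<close>

lemma affine_two_points_closed_segment:
  fixes x y :: "'a::real_vector"
  assumes A: "affine A" and p: "p \<in> closed_segment x y" "p \<in> A" and q: "q \<in> closed_segment x y" "q \<in> A"
    and ne: "p \<noteq> q"
  shows "x \<in> A" "y \<in> A"
proof -
  obtain s t where s: "p = (1 - s) *\<^sub>R x + s *\<^sub>R y" and t: "q = (1 - t) *\<^sub>R x + t *\<^sub>R y"
    using p q by (auto simp: in_segment)
  have st: "s - t \<noteq> 0" using ne s t by auto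
  have *: "(1 - r) *\<^sub>R p + r *\<^sub>R q \<in> A" for r
    using A p(2) q(2) by (auto simp: affine_alt)
  have eq: "(1 - r) *\<^sub>R p + r *\<^sub>R q = (1 - (s + r * (t - s))) *\<^sub>R x + (s + r * (t - s)) *\<^sub>R y" for r
    unfolding s t by (simp add: algebra_simps)
  \<comment> \<open>These are the parameters at which the line through \<open>p\<close> and
    \<open>q\<close> reaches \<open>x\<close> and \<open>y\<close>.\<close>
  have "s + (s / (s - t)) * (t - s) = 0" "s + ((s - 1) / (s - t)) * (t - s) = 1"
    using st by (simp_all add: field_simps)
  then show "x \<in> A" "y \<in> A"
    using *[of "s / (s - t)"] *[of "(s - 1) / (s - t)"] unfolding eq by simp_all
qed

text \<open>This is the general position argument behind purity and generic segments. If no member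
  contains \<open>K\<close>, there are \<open>x\<close> and \<open>y\<close> in \<open>K\<close>
  that no member contains together. Each member then meets the segment in finitely many points,
  while the segment is infinite.\<close>

lemma convex_subset_Union_affine:
  fixes K :: "'a::real_normed_vector set"
  assumes "finite \<A>" "\<forall>A\<in>\<A>. affine A" "convex K" "K \<noteq> {}" "K \<subseteq> \<Union>\<A>"
  shows "\<exists>A\<in>\<A>. K \<subseteq> A"
  using assms
proof (induction \<A> rule: finite_induct)
  case (insert A \<A>)
  show ?case
  proof (rule ccontr)
    assume no: "\<not> ?thesis"
    then obtain x where x: "x \<in> K" "x \<notin> A" by blast
    have "\<not> K \<subseteq> \<Union>\<A>" using insert.IH insert.prems no by blast
    then obtain y where y: "y \<in> K" "y \<notin> \<Union>\<A>" by blast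
    have xy: "x \<noteq> y" using x y insert.prems by blast
    have sub: "closed_segment x y \<subseteq> \<Union>(insert A \<A>)"
      using closed_segment_subset[OF x(1) y(1)] insert.prems by blast
    have fin: "finite (B \<inter> closed_segment x y)" if B: "B \<in> insert A \<A>" for B
    proof (rule ccontr)
      assume inf: "infinite (B \<inter> closed_segment x y)"
      then obtain p where p: "p \<in> B \<inter> closed_segment x y" by (metis finite.emptyI ex_in_conv)
      have "infinite (B \<inter> closed_segment x y - {p})" using inf by simp
      then obtain q where q: "q \<in> B \<inter> closed_segment x y - {p}" by (metis finite.emptyI ex_in_conv)
      have "affine B" using insert.prems B by blast
      then have "x \<in> B" "y \<in> B"
        using affine_two_points_closed_segment[of B p x y q] p q by blast+
      then show False using x y B by blast
    qed
    have "closed_segment x y = (\<Union>B\<in>insert A \<A>. B \<inter> closed_segment x y)" using sub by blast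
    moreover have "finite (\<Union>B\<in>insert A \<A>. B \<inter> closed_segment x y)"
      using fin insert.hyps by blast
    ultimately show False using xy by simp
  qed
qed auto

corollary convex_subset_Union_affine_hull:
  fixes K :: "'a::real_normed_vector set"
  assumes "finite \<L>" "convex K" "K \<noteq> {}" and sub: "K \<subseteq> (\<Union>L\<in>\<L>. affine hull (f L))"
  obtains L where "L \<in> \<L>" "K \<subseteq> affine hull (f L)"
proof -
  have "\<exists>A\<in>(\<lambda>L. affine hull (f L)) ` \<L>. K \<subseteq> A"
    by (rule convex_subset_Union_affine) (use assms in simp_all)
  then show ?thesis using that by blast
qed

lemma geometric_triangulationD:
  assumes "geometric_triangulation \<Gamma> \<Delta>"
  shows "finite \<Gamma>" "\<Union>\<Gamma> = \<Delta>" "S \<in> \<Gamma> \<Longrightarrow> S \<subseteq> \<Delta>" "S \<in> \<Gamma> \<Longrightarrow> convex S" "S \<in> \<Gamma> \<Longrightarrow> closed S"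
    "S \<in> \<Gamma> \<Longrightarrow> F face_of S \<Longrightarrow> F \<in> \<Gamma>" "S \<in> \<Gamma> \<Longrightarrow> S' \<in> \<Gamma> \<Longrightarrow> S \<inter> S' face_of S"
    "S \<in> \<Gamma> \<Longrightarrow> \<exists>n. n simplex S"
  using assms convex_simplex closed_simplex
  unfolding geometric_triangulation_def simplicial_complex_def by blast+

text \<open>If \<open>p\<close> were on no full-dimensional simplex, a small ball around
  \<open>p\<close> would miss all of them. The part of \<open>K\<close> in the ball, still of full
  dimension, would then lie in the affine hull of a single lower-dimensional simplex.\<close>

lemma geometric_triangulation_pure:
  assumes tri: "geometric_triangulation \<Gamma> K" and K: "convex K" and p: "p \<in> K"
  shows "\<exists>S\<in>\<Gamma>. p \<in> S \<and> aff_dim S = aff_dim K"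
proof (rule ccontr)
  note tri = geometric_triangulationD[OF tri]
  assume no: "\<not> ?thesis"
  define U where "U = \<Union>{S \<in> \<Gamma>. aff_dim S = aff_dim K}"
  have "closed U" unfolding U_def using tri(1,5) by (intro closed_Union) auto
  moreover have "p \<notin> U" using no by (auto simp: U_def)
  ultimately obtain e where e: "e > 0" "ball p e \<subseteq> - U"
    using open_contains_ball[of "- U"] by auto
  let ?K = "K \<inter> ball p e"
  have ne: "?K \<noteq> {}" using p e by auto
  have sub: "?K \<subseteq> (\<Union>S\<in>{S \<in> \<Gamma>. aff_dim S \<noteq> aff_dim K}. affine hull S)"
  proof
    fix x assume x: "x \<in> ?K"
    then obtain S where S: "S \<in> \<Gamma>" "x \<in> S" using tri(2) by blast
    then have "aff_dim S \<noteq> aff_dim K" using x e by (auto simp: U_def)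
    then show "x \<in> (\<Union>S\<in>{S \<in> \<Gamma>. aff_dim S \<noteq> aff_dim K}. affine hull S)"
      using S hull_inc[of x S affine] by blast
  qed
  have "finite {S \<in> \<Gamma>. aff_dim S \<noteq> aff_dim K}" "convex ?K" using tri(1) K by (auto intro: convex_Int)
  then obtain S where "S \<in> {S \<in> \<Gamma>. aff_dim S \<noteq> aff_dim K}" and S3: "?K \<subseteq> affine hull S"
    using convex_subset_Union_affine_hull[OF _ _ ne sub] by blast
  then have S: "S \<in> \<Gamma>" "aff_dim S \<noteq> aff_dim K" by auto
  have "aff_dim K = aff_dim ?K"
    using aff_dim_convex_Int_open[OF K open_ball ne] by simp
  also have "\<dots> \<le> aff_dim S" using aff_dim_subset[OF S3] by simp
  finally show False using S(2) aff_dim_subset[OF tri(3)[OF S(1)]] by simp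
qed

text \<open>For \<open>S\<close> in the triangulation, \<open>F \<inter> S\<close> is a face of
  \<open>S\<close>, so it belongs to the complex; such intersections cover \<open>F\<close>.\<close>

lemma geometric_triangulation_restriction:
  assumes tri: "geometric_triangulation \<Gamma> \<Delta>" and F: "F face_of \<Delta>"
  shows "geometric_triangulation (restriction \<Gamma> F) F"
proof -
  note D = geometric_triangulationD[OF tri]
  have "F \<subseteq> \<Union>(restriction \<Gamma> F)"
  proof
    fix x assume x: "x \<in> F"
    then obtain S where S: "S \<in> \<Gamma>" "x \<in> S" using D(2) face_of_imp_subset[OF F] by blast
    have "F \<inter> S face_of \<Delta> \<inter> S" using F D(4)[OF S(1)] by (rule face_of_slice)
    then have "F \<inter> S face_of S" using D(3)[OF S(1)] by (simp add: Int_absorb1)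
    then have "F \<inter> S \<in> restriction \<Gamma> F" using D(6) S(1) by (auto simp: restriction_def)
    then show "x \<in> \<Union>(restriction \<Gamma> F)" using x S by blast
  qed
  moreover have "simplicial_complex (restriction \<Gamma> F)"
    unfolding simplicial_complex_def
  proof (intro conjI ballI allI impI)
    show "finite (restriction \<Gamma> F)" using D(1) by (simp add: restriction_def)
    show "\<exists>n. n simplex S" if "S \<in> restriction \<Gamma> F" for S
      using that D(8) by (simp add: restriction_def)
    show "G \<in> restriction \<Gamma> F" if "S \<in> restriction \<Gamma> F \<and> G face_of S" for G S
      using that D(6)[of S G] face_of_imp_subset[of G S] unfolding restriction_def by blast
    show "S \<inter> S' face_of S" if "S \<in> restriction \<Gamma> F \<and> S' \<in> restriction \<Gamma> F" for S S'
      using that D(7) by (simp add: restriction_def)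
  qed
  ultimately show ?thesis unfolding geometric_triangulation_def by (auto simp: restriction_def)
qed

text \<open>\<open>S \<inter> A\<close> is a face of \<open>S\<close> that meets the relative
  interior of \<open>S\<close>, so it is all of \<open>S\<close>.\<close>

lemma geometric_triangulation_star:
  assumes tri: "geometric_triangulation \<Gamma> \<Delta>" and "S \<in> \<Gamma>" "A \<in> \<Gamma>" "x \<in> rel_interior S" "x \<in> A"
  shows "S \<subseteq> A"
proof -
  have "S \<inter> A face_of S" using geometric_triangulationD(7)[OF tri] assms by blast
  moreover have "x \<in> S" using assms rel_interior_subset by blast
  ultimately show ?thesis using subset_of_face_of[of "S \<inter> A" S S] assms by blast
qed

text \<open>A generic segment between points of two top-dimensional simplices avoids all simplices of
  codimension at least two, hence crosses ridges only.\<close>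

lemma geometric_triangulation_ridge_connected:
  assumes tri: "geometric_triangulation \<Gamma> \<Delta>" and \<Delta>: "convex \<Delta>"
    and O: "open U" "convex U"
    and A: "A \<in> \<Gamma>" "aff_dim A = aff_dim \<Delta>" "A \<inter> U \<noteq> {}" "P A"
    and B: "B \<in> \<Gamma>" "aff_dim B = aff_dim \<Delta>" "B \<inter> U \<noteq> {}"
    and step: "\<And>S S'. \<lbrakk>S \<in> \<Gamma>; S' \<in> \<Gamma>; aff_dim S = aff_dim \<Delta>; aff_dim S' = aff_dim \<Delta>; P S;
      aff_dim (S \<inter> S') = aff_dim \<Delta> - 1; S \<inter> S' \<inter> U \<noteq> {}; S \<inter> S' \<inter> rel_interior \<Delta> \<noteq> {}\<rbrakk> \<Longrightarrow> P S'"
  shows "P B"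
proof (rule ccontr)
  note D = geometric_triangulationD[OF tri]
  assume notP: "\<not> P B"
  have ri: "rel_interior S \<inter> U \<noteq> {}" "aff_dim (rel_interior S \<inter> U) = aff_dim S"
    if "S \<in> \<Gamma>" "S \<inter> U \<noteq> {}" for S
  proof -
    have cl: "closure (rel_interior S) = closure S"
      by (rule convex_closure_rel_interior) (rule D(4)[OF that(1)])
    have "U \<inter> closure S \<noteq> {}" using that(2) closure_subset by blast
    then show ne: "rel_interior S \<inter> U \<noteq> {}"
      using open_Int_closure_eq_empty[OF O(1), of "rel_interior S"] unfolding cl by blast
    have "aff_dim (rel_interior S \<inter> U) = aff_dim (rel_interior S)"
      by (rule aff_dim_convex_Int_open) (use D(4)[OF that(1)] O ne convex_rel_interior in auto)
    also have "\<dots> = aff_dim (affine hull rel_interior S)" by simp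
    also have "\<dots> = aff_dim S" using rel_interior_same_affine_hull[OF D(4)[OF that(1)]] by simp
    finally show "aff_dim (rel_interior S \<inter> U) = aff_dim S" .
  qed
  have ri_sub: "rel_interior S \<subseteq> rel_interior \<Delta>" if "S \<in> \<Gamma>" "aff_dim S = aff_dim \<Delta>" "S \<noteq> {}" for S
  proof -
    have "affine hull S = affine hull \<Delta>"
      using that(2,3) by (intro affine_dim_equal hull_mono D(3)[OF that(1)]) auto
    then show ?thesis by (intro subset_rel_interior D(3)[OF that(1)])
  qed
  define \<L> where "\<L> = {L \<in> \<Gamma>. aff_dim L \<le> aff_dim \<Delta> - 2}"
  obtain x where x: "x \<in> rel_interior A" "x \<in> U" using ri(1)[OF A(1,3)] by blast
  let ?K = "rel_interior B \<inter> U"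
  \<comment> \<open>Joining \<open>x\<close> to a simplex of codimension at least two spans
    dimension below that of \<Delta>, so finitely many such hulls cannot cover the full-dimensional
    \<open>?K\<close>. A point \<open>y\<close> off them gives the generic segment.\<close>
  have "\<not> ?K \<subseteq> (\<Union>L\<in>\<L>. affine hull (insert x L))"
  proof
    assume sub: "?K \<subseteq> (\<Union>L\<in>\<L>. affine hull (insert x L))"
    have "finite \<L>" using D(1) by (simp add: \<L>_def)
    moreover have "convex ?K" by (intro convex_Int convex_rel_interior D(4)[OF B(1)] O(2))
    ultimately obtain L where L: "L \<in> \<L>" "?K \<subseteq> affine hull (insert x L)"
      by (rule convex_subset_Union_affine_hull[OF _ _ ri(1)[OF B(1,3)] sub])
    have "aff_dim \<Delta> \<le> aff_dim (insert x L)"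
      using aff_dim_subset[OF L(2)] ri(2)[OF B(1,3)] B(2) by simp
    also have "\<dots> \<le> aff_dim L + 1" by (simp add: aff_dim_insert)
    finally have "aff_dim \<Delta> \<le> aff_dim L + 1" .
    moreover have "aff_dim L \<le> aff_dim \<Delta> - 2" using L(1) unfolding \<L>_def by blast
    ultimately show False by linarith
  qed
  then obtain y where y0: "y \<in> ?K" "y \<notin> (\<Union>L\<in>\<L>. affine hull (insert x L))"
    by (meson subsetI)
  then have y: "y \<in> rel_interior B" "y \<in> U" "\<And>L. L \<in> \<L> \<Longrightarrow> y \<notin> affine hull (insert x L)"
    by simp_all
  \<comment> \<open>If \<open>z = x\<close>, then \<open>A \<subseteq> L\<close>, which is
    impossible by dimension. Otherwise \<open>y\<close> is on the line through \<open>x\<close> and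
    \<open>z\<close>, hence in the excluded hull.\<close>
  have avoid: "z \<notin> L" if z: "z \<in> closed_segment x y" and L: "L \<in> \<L>" for z L
  proof
    assume zL: "z \<in> L"
    obtain u where u: "z = (1 - u) *\<^sub>R x + u *\<^sub>R y" using z by (auto simp: in_segment)
    show False
    proof (cases "u = 0")
      case True
      then have "x \<in> L" using zL u by simp
      moreover have "L \<in> \<Gamma>" using L unfolding \<L>_def by blast
      ultimately have "A \<subseteq> L"
        using geometric_triangulation_star[OF tri A(1) _ x(1)] by blast
      then have "aff_dim \<Delta> \<le> aff_dim L" using aff_dim_subset A(2) by metis
      moreover have "aff_dim L \<le> aff_dim \<Delta> - 2" using L unfolding \<L>_def by blast
      ultimately show False by linarith
    next
      case False
      have "(1 - 1 / u) *\<^sub>R x + (1 / u) *\<^sub>R z =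
          (1 - 1 / u + (1 / u) * (1 - u)) *\<^sub>R x + ((1 / u) * u) *\<^sub>R y"
        unfolding u by (simp add: scaleR_add_left scaleR_add_right del: scaleR_left_diff_distrib)
      also have "\<dots> = y" using False by (simp add: field_simps)
      finally have "y = (1 - 1 / u) *\<^sub>R x + (1 / u) *\<^sub>R z" ..
      moreover have "x \<in> affine hull (insert x L)" "z \<in> affine hull (insert x L)"
        using zL by (simp_all add: hull_inc)
      ultimately have "y \<in> affine hull (insert x L)"
        using affine_affine_hull[of "insert x L"] unfolding affine_alt by simp
      then show False using y(3) L by blast
    qed
  qed
  have xA: "x \<in> A" and yB: "y \<in> B" using x y rel_interior_subset by blast+
  have seg_U: "closed_segment x y \<subseteq> U" using x y O(2) by (simp add: closed_segment_subset)
  have "A \<noteq> {}" "B \<noteq> {}" using xA yB by auto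
  then have "x \<in> rel_interior \<Delta>" "y \<in> rel_interior \<Delta>"
    using x(1) y(1) ri_sub[OF A(1,2)] ri_sub[OF B(1,2)] by auto
  then have seg_\<Delta>: "closed_segment x y \<subseteq> rel_interior \<Delta>"
    using convex_rel_interior[OF \<Delta>] by (rule closed_segment_subset)
  \<comment> \<open>\<open>X\<close> and \<open>Y\<close> are closed and cover the connected
    segment, with \<open>x\<close> in \<open>X\<close> and \<open>y\<close> in \<open>Y\<close>; so
    they meet at a point \<open>z\<close> of the segment.\<close>
  define X where "X = \<Union>{S \<in> \<Gamma>. aff_dim S = aff_dim \<Delta> \<and> P S}"
  define Y where "Y = \<Union>{S \<in> \<Gamma>. aff_dim S = aff_dim \<Delta> \<and> \<not> P S}"
  have "closed X" unfolding X_def using D(1,5) by (intro closed_Union) auto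
  moreover have "closed Y" unfolding Y_def using D(1,5) by (intro closed_Union) auto
  moreover have "closed_segment x y \<subseteq> X \<union> Y"
  proof
    fix z assume "z \<in> closed_segment x y"
    then have "z \<in> \<Delta>" using seg_\<Delta> rel_interior_subset[of \<Delta>] by blast
    then obtain S where "S \<in> \<Gamma>" "z \<in> S" "aff_dim S = aff_dim \<Delta>"
      using geometric_triangulation_pure[OF tri \<Delta>] by blast
    then show "z \<in> X \<union> Y" by (cases "P S") (auto simp: X_def Y_def)
  qed
  ultimately have "X \<inter> Y \<inter> closed_segment x y = {} \<Longrightarrow>
      X \<inter> closed_segment x y = {} \<or> Y \<inter> closed_segment x y = {}"
    by (intro connected_closedD) auto
  moreover have "x \<in> X \<inter> closed_segment x y" using xA A by (auto simp: X_def)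
  moreover have "y \<in> Y \<inter> closed_segment x y" using yB B notP by (auto simp: Y_def)
  ultimately obtain z where z0: "z \<in> X" "z \<in> Y" "z \<in> closed_segment x y" by blast
  obtain S where S: "S \<in> \<Gamma>" "aff_dim S = aff_dim \<Delta>" "P S" "z \<in> S" using z0(1) by (auto simp: X_def)
  obtain S' where S': "S' \<in> \<Gamma>" "aff_dim S' = aff_dim \<Delta>" "\<not> P S'" "z \<in> S'"
    using z0(2) by (auto simp: Y_def)
  note z = z0(3) S(4) S'(4)
  have face: "S \<inter> S' face_of S" "S' \<inter> S face_of S'"
    using D(7)[OF S(1) S'(1)] D(7)[OF S'(1) S(1)] by simp_all
  have "S \<inter> S' \<in> \<Gamma>" using D(6)[OF S(1) face(1)] .
  then have "\<not> aff_dim (S \<inter> S') \<le> aff_dim \<Delta> - 2" using avoid[OF z(1)] z by (auto simp: \<L>_def)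
  moreover have "aff_dim (S \<inter> S') < aff_dim \<Delta>"
  proof (rule ccontr)
    assume "\<not> ?thesis"
    then have "S \<inter> S' = S" using face_of_aff_dim_lt[OF D(4)[OF S(1)] face(1)] S(2) by metis
    moreover have "S' \<inter> S = S'"
      using face_of_aff_dim_lt[OF D(4)[OF S'(1)] face(2)] S'(2) \<open>\<not> aff_dim (S \<inter> S') < aff_dim \<Delta>\<close>
      by (metis Int_commute)
    ultimately have "S = S'" by blast
    then show False using S(3) S'(3) by simp
  qed
  ultimately have dim: "aff_dim (S \<inter> S') = aff_dim \<Delta> - 1" by simp
  have "z \<in> U" "z \<in> rel_interior \<Delta>" using z(1) seg_U seg_\<Delta> by auto
  then have "S \<inter> S' \<inter> U \<noteq> {}" "S \<inter> S' \<inter> rel_interior \<Delta> \<noteq> {}" using z by auto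
  then have "P S'" by (rule step[OF S(1) S'(1) S(2) S'(2) S(3) dim])
  then show False using S'(3) by simp
qed

subsection \<open>Faces of the simplex and top-dimensional simplices\<close>

definition verts :: "'a::euclidean_space set \<Rightarrow> 'a set" where
  "verts S = {v. v extreme_point_of S}"

locale simplex_triangulation =
  fixes \<Gamma> :: "'a::euclidean_space set set" and \<Delta> :: "'a set" and V\<^sub>0 :: "'a set"
  assumes indep: "\<not> affine_dependent V\<^sub>0"
    and \<Delta>_eq: "\<Delta> = convex hull V\<^sub>0"
    and tri: "geometric_triangulation \<Gamma> \<Delta>"
begin

lemmas tri_simps = geometric_triangulationD[OF tri]

text \<open>Facets are indexed by the opposite vertex of \<Delta>.\<close>

definition facet :: "'a \<Rightarrow> 'a set" where
  "facet i = convex hull (V\<^sub>0 - {i})"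

text \<open>The vertex set of the carrier of \<open>G\<close>, see \<open>carrier_face_eq\<close>:
  those \<open>i\<close> whose barycentric coordinate does not vanish identically on
  \<open>G\<close>.\<close>

definition support :: "'a set \<Rightarrow> 'a set" where
  "support G = {i \<in> V\<^sub>0. \<not> G \<subseteq> facet i}"

definition facets_at :: "'a \<Rightarrow> 'a set" where
  "facets_at v = {i \<in> V\<^sub>0. v \<in> facet i}"

lemma fin_V0: "finite V\<^sub>0"
  using indep by (rule aff_independent_finite)

lemma convex_\<Delta>: "convex \<Delta>"
  by (simp add: \<Delta>_eq)

lemma aff_dim_hull: "c \<subseteq> V\<^sub>0 \<Longrightarrow> aff_dim (convex hull c) = int (card c) - 1"
  using aff_dim_affine_independent[OF affine_independent_subset[OF indep]] by (simp add: aff_dim_convex_hull)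

lemma aff_dim_\<Delta>: "aff_dim \<Delta> = int (card V\<^sub>0) - 1"
  by (simp add: \<Delta>_eq aff_dim_hull)

lemma face_of_\<Delta>: "F face_of \<Delta> \<longleftrightarrow> (\<exists>c\<subseteq>V\<^sub>0. F = convex hull c)"
  unfolding \<Delta>_eq by (rule face_of_convex_hull_affine_independent[OF indep])

text \<open>Convex hulls of subsets of an affinely independent set commute with
  intersections.\<close>

lemma hull_eq_Inter_facets:
  assumes "c \<subseteq> V\<^sub>0"
  shows "convex hull c = \<Delta> \<inter> (\<Inter>i\<in>V\<^sub>0 - c. facet i)"
proof -
  \<comment> \<open>Inserting \<open>V\<^sub>0\<close> keeps the family nonempty, with union
    \<open>V\<^sub>0\<close>, even when \<open>c = V\<^sub>0\<close>.\<close>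
  let ?S = "insert V\<^sub>0 ((\<lambda>i. V\<^sub>0 - {i}) ` (V\<^sub>0 - c))"
  have un: "\<Union>?S = V\<^sub>0" and int: "\<Inter>?S = c" using assms by auto
  have "convex hull (\<Inter>?S) = (\<Inter>T\<in>?S. convex hull T)"
    by (rule convex_hull_Inter) (simp only: un indep not_False_eq_True)
  then show ?thesis unfolding int by (simp add: \<Delta>_eq facet_def)
qed

lemma subset_hull_iff:
  assumes "G \<subseteq> \<Delta>" "c \<subseteq> V\<^sub>0"
  shows "G \<subseteq> convex hull c \<longleftrightarrow> support G \<subseteq> c"
  using assms by (auto simp: hull_eq_Inter_facets support_def)

lemma support_subset: "support G \<subseteq> V\<^sub>0"
  by (auto simp: support_def)

lemma hull_subset_hull_iff:
  assumes "c \<subseteq> V\<^sub>0" "c' \<subseteq> V\<^sub>0"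
  shows "convex hull c \<subseteq> convex hull c' \<longleftrightarrow> c \<subseteq> c'"
proof
  assume *: "convex hull c \<subseteq> convex hull c'"
  show "c \<subseteq> c'"
  proof
    fix v assume v: "v \<in> c"
    have "v extreme_point_of convex hull V\<^sub>0"
      using extreme_point_of_convex_hull_affine_independent[OF indep] v assms by blast
    moreover have "convex hull c' face_of convex hull V\<^sub>0" using face_of_\<Delta> assms \<Delta>_eq by blast
    ultimately have "v extreme_point_of convex hull c'"
      using extreme_point_of_face * hull_inc[OF v, of convex] by blast
    then show "v \<in> c'" by (rule extreme_point_of_convex_hull)
  qed
qed (rule hull_mono)

lemma carrier_face_eq:
  assumes "G \<subseteq> \<Delta>"
  shows "carrier_face \<Delta> G = convex hull (support G)"
proof (rule antisym)
  have "G \<subseteq> convex hull (support G)" using subset_hull_iff[OF assms support_subset] by blast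
  moreover have "convex hull (support G) face_of \<Delta>" using face_of_\<Delta> support_subset by blast
  ultimately show "carrier_face \<Delta> G \<subseteq> convex hull (support G)"
    using carrier_face_least(3)[OF convex_\<Delta> assms] by blast
  obtain c where c: "c \<subseteq> V\<^sub>0" "carrier_face \<Delta> G = convex hull c"
    using carrier_face_least(1)[OF convex_\<Delta> assms] face_of_\<Delta> by blast
  then have "support G \<subseteq> c"
    using carrier_face_least(2)[OF convex_\<Delta> assms] subset_hull_iff[OF assms] by simp
  then show "convex hull (support G) \<subseteq> carrier_face \<Delta> G" unfolding c(2) by (rule hull_mono)
qed

lemma carrier_face_eq_\<Delta>_iff:
  assumes "G \<subseteq> \<Delta>" shows "carrier_face \<Delta> G = \<Delta> \<longleftrightarrow> support G = V\<^sub>0"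
  using carrier_face_eq[OF assms] hull_subset_hull_iff[OF order_refl support_subset] support_subset
  by (metis \<Delta>_eq order_refl subset_antisym)

lemma support_singleton: "support {v} = V\<^sub>0 - facets_at v"
  by (auto simp: support_def facets_at_def)

lemma facets_at_subset: "facets_at v \<subseteq> V\<^sub>0"
  by (auto simp: facets_at_def)

lemma card_support_singleton: "card (support {v}) + card (facets_at v) = card V\<^sub>0"
  unfolding support_singleton
  using card_Diff_subset[OF finite_subset[OF facets_at_subset fin_V0] facets_at_subset]
    card_mono[OF fin_V0 facets_at_subset] by simp

section \<open>Vertex sets of the simplices of the triangulation\<close>

lemma verts_simplex:
  assumes "S \<in> \<Gamma>"
  shows "\<not> affine_dependent (verts S)" "convex hull (verts S) = S"
    "int (card (verts S)) = aff_dim S + 1" "finite (verts S)"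
proof -
  obtain n C where C: "\<not> affine_dependent C" "S = convex hull C"
    using tri_simps(8)[OF assms] by (auto simp: simplex_def)
  have "verts S = C"
    using extreme_point_of_convex_hull_affine_independent[OF C(1)] C(2) by (auto simp: verts_def)
  then show "\<not> affine_dependent (verts S)" "convex hull (verts S) = S" "finite (verts S)"
    "int (card (verts S)) = aff_dim S + 1"
    using C aff_independent_finite[OF C(1)] aff_dim_affine_independent[OF C(1)]
    by (auto simp: aff_dim_convex_hull)
qed

lemma verts_subset: "verts S \<subseteq> S"
  by (auto simp: verts_def extreme_point_of_def)

lemma hull_in_\<Gamma>:
  assumes "S \<in> \<Gamma>" "c \<subseteq> verts S"
  shows "convex hull c \<in> \<Gamma>"
proof -
  have "convex hull c face_of convex hull (verts S)"
    using face_of_convex_hull_affine_independent[OF verts_simplex(1)[OF assms(1)]] assms(2) by blast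
  then show ?thesis using tri_simps(6)[OF assms(1)] verts_simplex(2)[OF assms(1)] by simp
qed

lemma verts_hull:
  assumes "S \<in> \<Gamma>" "c \<subseteq> verts S"
  shows "verts (convex hull c) = c"
  using extreme_point_of_convex_hull_affine_independent[OF affine_independent_subset[OF verts_simplex(1)[OF assms(1)] assms(2)]]
  by (auto simp: verts_def)

lemma verts_mono:
  assumes "S \<in> \<Gamma>" "A \<in> \<Gamma>" "S \<subseteq> A"
  shows "verts S \<subseteq> verts A"
proof -
  have "S face_of A" using tri_simps(7)[OF assms(2,1)] assms(3) by (simp add: Int_absorb1)
  then show ?thesis using extreme_point_of_face by (auto simp: verts_def)
qed

lemma verts_Int:
  assumes "A \<in> \<Gamma>" "B \<in> \<Gamma>"
  shows "verts (A \<inter> B) = verts A \<inter> verts B"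
proof
  have AB: "A \<inter> B \<in> \<Gamma>" using tri_simps(6)[OF assms(1) tri_simps(7)[OF assms]] .
  show "verts (A \<inter> B) \<subseteq> verts A \<inter> verts B"
    using verts_mono[OF AB assms(1)] verts_mono[OF AB assms(2)] by blast
  show "verts A \<inter> verts B \<subseteq> verts (A \<inter> B)"
    using extreme_point_of_Int by (auto simp: verts_def)
qed

lemma singleton_in_\<Gamma>:
  assumes "S \<in> \<Gamma>" "v \<in> verts S"
  shows "{v} \<in> \<Gamma>"
  using hull_in_\<Gamma>[of S "{v}"] assms by simp

definition tops :: "'a set set" where
  "tops = verts ` {S \<in> \<Gamma>. aff_dim S = aff_dim \<Delta>}"

lemma topsE:
  assumes "C \<in> tops"
  obtains S where "S \<in> \<Gamma>" "aff_dim S = aff_dim \<Delta>" "C = verts S"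
  using assms by (auto simp: tops_def)

lemma ex_top_containing:
  assumes "p \<in> \<Delta>"
  shows "\<exists>A. A \<in> \<Gamma> \<and> aff_dim A = aff_dim \<Delta> \<and> p \<in> A"
  using geometric_triangulation_pure[OF tri convex_\<Delta> assms] by blast

text \<open>A full-dimensional simplex through a relative interior point of \<open>S\<close>
  contains \<open>S\<close> by the star property.\<close>

lemma ex_top_above:
  assumes S: "S \<in> \<Gamma>" "S \<noteq> {}"
  shows "\<exists>A. A \<in> \<Gamma> \<and> verts S \<subseteq> verts A \<and> verts A \<in> tops"
proof -
  have "rel_interior S \<noteq> {}" using S rel_interior_eq_empty[OF tri_simps(4)[OF S(1)]] by simp
  then obtain p where p: "p \<in> rel_interior S" by blast
  then have "p \<in> \<Delta>" using rel_interior_subset[of S] tri_simps(3)[OF S(1)] by blast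
  then obtain A where A: "A \<in> \<Gamma>" "aff_dim A = aff_dim \<Delta>" "p \<in> A"
    using ex_top_containing by blast
  have "S \<subseteq> A" by (rule geometric_triangulation_star[OF tri S(1) A(1) p A(3)])
  then have "verts S \<subseteq> verts A" by (rule verts_mono[OF S(1) A(1)])
  moreover have "verts A \<in> tops" using A by (simp add: tops_def)
  ultimately show ?thesis using A(1) by blast
qed

lemma Union_tops: "v \<in> \<Union>tops \<longleftrightarrow> {v} \<in> \<Gamma>"
proof
  assume "v \<in> \<Union>tops"
  then obtain C where C: "C \<in> tops" "v \<in> C" by blast
  obtain S where "S \<in> \<Gamma>" "C = verts S" using C(1) by (rule topsE)
  then show "{v} \<in> \<Gamma>" using singleton_in_\<Gamma>[of S v] C(2) by simp
next
  assume "{v} \<in> \<Gamma>"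
  then have "\<exists>A. A \<in> \<Gamma> \<and> verts {v} \<subseteq> verts A \<and> verts A \<in> tops"
    by (rule ex_top_above) simp
  then obtain A where "verts {v} \<subseteq> verts A" "verts A \<in> tops" by blast
  moreover have "v \<in> verts {v}" by (simp add: verts_def extreme_point_of_def)
  ultimately show "v \<in> \<Union>tops" by blast
qed

lemma facet_face: "i \<in> V\<^sub>0 \<Longrightarrow> facet i face_of \<Delta>"
  unfolding face_of_\<Delta> facet_def by blast

lemma subset_facet_iff:
  assumes "S \<in> \<Gamma>"
  shows "S \<subseteq> facet i \<longleftrightarrow> verts S \<subseteq> facet i"
proof
  assume "verts S \<subseteq> facet i"
  then have "convex hull (verts S) \<subseteq> facet i" by (rule hull_minimal) (simp add: facet_def)
  then show "S \<subseteq> facet i" using verts_simplex(2)[OF assms] by simp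
qed (use verts_subset in blast)

text \<open>\<open>S\<close> is affinely independent and lies in the face spanned by
  \<open>V\<^sub>0 - J\<close>, whose dimension bounds its size.\<close>

lemma top_bound:
  assumes C: "C \<in> tops" and S: "S \<subseteq> C" and J: "J \<subseteq> V\<^sub>0" and SJ: "\<And>v. v \<in> S \<Longrightarrow> J \<subseteq> facets_at v"
  shows "card S + card J \<le> card V\<^sub>0"
proof -
  obtain A where A: "A \<in> \<Gamma>" "C = verts A" using C by (rule topsE)
  have "S \<subseteq> \<Delta>" using S A verts_subset tri_simps(3) by blast
  moreover have "support S \<subseteq> V\<^sub>0 - J" using SJ by (auto simp: support_def facets_at_def)
  ultimately have "S \<subseteq> convex hull (V\<^sub>0 - J)" using subset_hull_iff[of S "V\<^sub>0 - J"] by blast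
  then have "aff_dim S \<le> aff_dim (convex hull (V\<^sub>0 - J))" by (rule aff_dim_subset)
  also have "\<dots> = int (card (V\<^sub>0 - J)) - 1" by (rule aff_dim_hull) blast
  finally have "int (card S) \<le> int (card (V\<^sub>0 - J))"
    using aff_dim_affine_independent[OF affine_independent_subset[OF verts_simplex(1)[OF A(1)]]] S A(2)
    by fastforce
  moreover have "card (V\<^sub>0 - J) = card V\<^sub>0 - card J" "card J \<le> card V\<^sub>0"
    using J fin_V0 by (auto simp: card_Diff_subset finite_subset card_mono)
  ultimately show ?thesis by linarith
qed

text \<open>Purity of the triangulation restricted to the face spanned by
  \<open>V\<^sub>0 - T\<close> yields a simplex of the full dimension of that face.\<close>

lemma ex_simplex_in_face:
  assumes T: "T \<subseteq> V\<^sub>0" "T \<noteq> V\<^sub>0"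
  shows "\<exists>\<tau>. card \<tau> + card T = card V\<^sub>0 \<and> (\<exists>C\<in>tops. \<tau> \<subseteq> C) \<and> (\<forall>v\<in>\<tau>. T \<subseteq> facets_at v)"
proof -
  let ?F = "convex hull (V\<^sub>0 - T)"
  have F: "?F face_of \<Delta>" using face_of_\<Delta> by blast
  obtain p where p: "p \<in> ?F" using T hull_inc[of _ "V\<^sub>0 - T" convex] by blast
  obtain S where "S \<in> restriction \<Gamma> ?F" and pS: "p \<in> S" and dimS: "aff_dim S = aff_dim ?F"
    using geometric_triangulation_pure[OF geometric_triangulation_restriction[OF tri F] _ p] by auto
  then have S: "S \<in> \<Gamma>" "S \<subseteq> ?F" by (auto simp: restriction_def)
  have "S \<noteq> {}" using pS by auto
  then obtain A where A: "verts S \<subseteq> verts A" "verts A \<in> tops" using ex_top_above[OF S(1)] by blast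
  have "int (card (verts S)) = int (card (V\<^sub>0 - T))"
    using verts_simplex(3)[OF S(1)] dimS aff_dim_hull[of "V\<^sub>0 - T"] by auto
  moreover have "card (V\<^sub>0 - T) = card V\<^sub>0 - card T" "card T \<le> card V\<^sub>0"
    using T fin_V0 by (auto simp: card_Diff_subset finite_subset card_mono)
  ultimately have "card (verts S) + card T = card V\<^sub>0" by linarith
  moreover have "T \<subseteq> facets_at v" if "v \<in> verts S" for v
  proof -
    have "v \<in> ?F" using that S(2) verts_subset by blast
    then show ?thesis using T(1) hull_eq_Inter_facets[of "V\<^sub>0 - T"] by (auto simp: facets_at_def)
  qed
  ultimately show ?thesis using A by blast
qed

text \<open>Purity of the restriction to facet \<open>a\<close>, used at a relative interior point
  of the hull of \<tau>, gives a ridge in the facet; by the star property it contains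
  \<tau>.\<close>

lemma ex_boundary_ridge:
  assumes C: "C \<in> tops" and \<tau>: "\<tau> \<subseteq> C" "\<tau> \<noteq> {}" and a: "a \<in> V\<^sub>0" and at: "\<And>v. v \<in> \<tau> \<Longrightarrow> a \<in> facets_at v"
  shows "\<exists>C'\<in>tops. \<tau> \<subseteq> C' \<and> card V\<^sub>0 - 1 \<le> card {v \<in> C'. a \<in> facets_at v}"
proof -
  obtain A where A: "A \<in> \<Gamma>" "C = verts A" using C by (rule topsE)
  define S where "S = convex hull \<tau>"
  have S: "S \<in> \<Gamma>" "verts S = \<tau>" using hull_in_\<Gamma> verts_hull A \<tau> by (auto simp: S_def)
  have "S \<noteq> {}" using \<tau> by (simp add: S_def)
  then have "rel_interior S \<noteq> {}" using rel_interior_eq_empty[OF tri_simps(4)[OF S(1)]] by simp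
  then obtain p where p: "p \<in> rel_interior S" by blast
  have "S \<subseteq> facet a" using subset_facet_iff[OF S(1)] S(2) at by (auto simp: facets_at_def)
  then have pF: "p \<in> facet a" using p rel_interior_subset by blast
  obtain R where "R \<in> restriction \<Gamma> (facet a)" and pR: "p \<in> R" and dimR: "aff_dim R = aff_dim (facet a)"
    using geometric_triangulation_pure[OF geometric_triangulation_restriction[OF tri facet_face[OF a]] _ pF]
    by (auto simp: facet_def)
  then have R: "R \<in> \<Gamma>" "R \<subseteq> facet a" by (auto simp: restriction_def)
  have SR: "S \<subseteq> R" using geometric_triangulation_star[OF tri S(1) R(1) p pR] .
  have "R \<noteq> {}" using pR by auto
  then obtain B where B: "verts R \<subseteq> verts B" "verts B \<in> tops" "B \<in> \<Gamma>"
    using ex_top_above[OF R(1)] by blast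
  have "int (card (verts R)) = int (card (V\<^sub>0 - {a}))"
    using verts_simplex(3)[OF R(1)] dimR aff_dim_hull[of "V\<^sub>0 - {a}"] by (auto simp: facet_def)
  then have "card V\<^sub>0 - 1 = card (verts R)" using a fin_V0 by simp
  also have "\<dots> \<le> card {v \<in> verts B. a \<in> facets_at v}"
  proof (rule card_mono)
    show "finite {v \<in> verts B. a \<in> facets_at v}" using verts_simplex(4)[OF B(3)] by simp
    show "verts R \<subseteq> {v \<in> verts B. a \<in> facets_at v}"
      using B(1) R(2) verts_subset[of R] a by (auto simp: facets_at_def)
  qed
  finally show ?thesis using B verts_mono[OF S(1) R(1) SR] S(2) by blast
qed

text \<open>Localises ridge-connectedness to the star of \<tau>: the segment is kept in an open set
  \<open>U\<close> that meets only simplices containing \<tau>.\<close>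

lemma tops_ridge_connected:
  assumes C: "C \<in> tops" "C' \<in> tops" and \<tau>: "\<tau> \<subseteq> C" "\<tau> \<subseteq> C'" and P: "P C"
    and ne: "V\<^sub>0 \<noteq> {}"
    and step: "\<And>A B. \<lbrakk>A \<in> tops; B \<in> tops; P A; \<tau> \<subseteq> A \<inter> B; Suc (card (A \<inter> B)) = card V\<^sub>0;
        \<And>c. c \<in> V\<^sub>0 \<Longrightarrow> \<exists>v\<in>A \<inter> B. c \<notin> facets_at v\<rbrakk> \<Longrightarrow> P B"
  shows "P C'"
proof -
  obtain A where A: "A \<in> \<Gamma>" "aff_dim A = aff_dim \<Delta>" "C = verts A" using C(1) by (rule topsE)
  obtain B where B: "B \<in> \<Gamma>" "aff_dim B = aff_dim \<Delta>" "C' = verts B" using C(2) by (rule topsE)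
  have dim_nonneg: "aff_dim \<Delta> \<ge> 0" using aff_dim_\<Delta> ne fin_V0 by (simp add: Suc_le_eq card_gt_0_iff)
  have ne': "A \<noteq> {}" "B \<noteq> {}" using dim_nonneg A(2) B(2) by auto
  have "\<exists>U. open U \<and> convex U \<and> A \<inter> U \<noteq> {} \<and> B \<inter> U \<noteq> {} \<and>
      (\<forall>S\<in>\<Gamma>. S \<inter> U \<noteq> {} \<longrightarrow> \<tau> \<subseteq> verts S)"
  proof (cases "\<tau> = {}")
    case True then show ?thesis using ne' by (intro exI[of _ UNIV]) auto
  next
    case False
    define S where "S = convex hull \<tau>"
    have S: "S \<in> \<Gamma>" "verts S = \<tau>" using hull_in_\<Gamma> verts_hull A \<tau> by (auto simp: S_def)
    have "S \<noteq> {}" using False by (simp add: S_def)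
    then have "rel_interior S \<noteq> {}" using rel_interior_eq_empty[OF tri_simps(4)[OF S(1)]] by simp
  then obtain p where p: "p \<in> rel_interior S" by blast
    have "S \<subseteq> A" "S \<subseteq> B"
      using hull_mono[of \<tau> "verts A" convex] hull_mono[of \<tau> "verts B" convex]
        verts_simplex(2)[OF A(1)] verts_simplex(2)[OF B(1)] A(3) B(3) \<tau> unfolding S_def by auto
    then have pA: "p \<in> A" "p \<in> B" using p rel_interior_subset by auto
    \<comment> \<open>A ball around \<open>p\<close> avoiding \<open>X\<close> meets only simplices
      through \<open>p\<close>, and these contain the hull of \<tau>.\<close>
    define X where "X = \<Union>{S \<in> \<Gamma>. p \<notin> S}"
    have "closed X" unfolding X_def using tri_simps(1,5) by (intro closed_Union) auto
    moreover have "p \<notin> X" by (auto simp: X_def)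
    ultimately obtain e where e: "e > 0" "ball p e \<subseteq> - X" using open_contains_ball[of "- X"] by auto
    have "\<tau> \<subseteq> verts K" if K: "K \<in> \<Gamma>" "K \<inter> ball p e \<noteq> {}" for K
    proof -
      have "p \<in> K" using K e(2) by (auto simp: X_def)
      then have "S \<subseteq> K" using geometric_triangulation_star[OF tri S(1) K(1) p] by blast
      then show ?thesis using verts_mono[OF S(1) K(1)] S(2) by simp
    qed
    moreover have "p \<in> ball p e" using e(1) by simp
    then have "A \<inter> ball p e \<noteq> {}" "B \<inter> ball p e \<noteq> {}" using pA by auto
    ultimately show ?thesis by (intro exI[of _ "ball p e"]) simp
  qed
  then obtain U where "open U \<and> convex U \<and> A \<inter> U \<noteq> {} \<and> B \<inter> U \<noteq> {} \<and>
      (\<forall>S\<in>\<Gamma>. S \<inter> U \<noteq> {} \<longrightarrow> \<tau> \<subseteq> verts S)" ..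
  then have U: "open U" "convex U" "A \<inter> U \<noteq> {}" "B \<inter> U \<noteq> {}"
    "\<And>S. S \<in> \<Gamma> \<Longrightarrow> S \<inter> U \<noteq> {} \<Longrightarrow> \<tau> \<subseteq> verts S" by simp_all
  have "P (verts B)"
  proof (rule geometric_triangulation_ridge_connected[OF tri convex_\<Delta> U(1,2) A(1,2) U(3) _ B(1,2) U(4),
        where P = "\<lambda>S. P (verts S)"])
    show "P (verts A)" using P A(3) by simp
    fix S S'
    assume S: "S \<in> \<Gamma>" "S' \<in> \<Gamma>" "aff_dim S = aff_dim \<Delta>" "aff_dim S' = aff_dim \<Delta>" "P (verts S)"
      and dim: "aff_dim (S \<inter> S') = aff_dim \<Delta> - 1" and SU: "S \<inter> S' \<inter> U \<noteq> {}"
      and ri: "S \<inter> S' \<inter> rel_interior \<Delta> \<noteq> {}"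
    have SS: "S \<inter> S' \<in> \<Gamma>" using tri_simps(6)[OF S(1) tri_simps(7)[OF S(1,2)]] .
    show "P (verts S')"
    proof (rule step[of "verts S"])
      show "verts S \<in> tops" "verts S' \<in> tops" using S by (auto simp: tops_def)
      show "P (verts S)" by fact
      show "\<tau> \<subseteq> verts S \<inter> verts S'" using U(5)[OF SS SU] verts_Int[OF S(1,2)] by simp
      show "Suc (card (verts S \<inter> verts S')) = card V\<^sub>0"
        using verts_simplex(3)[OF SS] dim aff_dim_\<Delta> unfolding verts_Int[OF S(1,2)] by linarith
      fix c assume c: "c \<in> V\<^sub>0"
      show "\<exists>v\<in>verts S \<inter> verts S'. c \<notin> facets_at v"
      proof (rule ccontr)
        assume "\<not> ?thesis"
        then have "S \<inter> S' \<subseteq> facet c"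
          using subset_facet_iff[OF SS] verts_Int[OF S(1,2)] by (auto simp: facets_at_def)
        \<comment> \<open>The ridge crosses the relative interior of \<Delta>, which no proper face
          meets.\<close>
        then have "facet c \<inter> rel_interior \<Delta> \<noteq> {}" using ri by blast
        then have "facet c = \<Delta>" using face_of_disjoint_rel_interior[OF facet_face[OF c]] by blast
        then have "card (V\<^sub>0 - {c}) = card V\<^sub>0"
          using aff_dim_hull[of "V\<^sub>0 - {c}"] aff_dim_\<Delta> by (auto simp: facet_def)
        then show False using c fin_V0 by (metis card_Diff1_less nat_neq_iff)
      qed
    qed
  qed
  then show ?thesis using B(3) by simp
qed

end

subsection \<open>The first coefficients of the local \<open>h\<close>-polynomial\<close>

text \<open>The left side of the identity defining the \<open>h\<close>-polynomial, as a linear map.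
  If \<open>degree p \<le> m\<close>, it equals (x + 1)^m p(1 / (x + 1)).\<close>

definition h_transform :: "nat \<Rightarrow> int poly \<Rightarrow> int poly" where
  "h_transform m p = (\<Sum>i\<le>m. smult (coeff p i) ([:1, 1:] ^ (m - i)))"

lemma h_transform_pCons_0: "h_transform (Suc m) (pCons 0 p) = h_transform m p"
  unfolding h_transform_def by (subst sum.atMost_Suc_shift) simp

lemma h_transform_Suc:
  assumes "degree p \<le> m"
  shows "h_transform (Suc m) p = [:1, 1:] * h_transform m p"
proof -
  have "h_transform (Suc m) p = (\<Sum>i\<le>m. smult (coeff p i) ([:1, 1:] ^ (Suc m - i)))"
    using assms by (simp add: h_transform_def coeff_eq_0)
  also have "\<dots> = (\<Sum>i\<le>m. [:1, 1:] * smult (coeff p i) ([:1, 1:] ^ (m - i)))"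
    by (intro sum.cong refl) (simp add: Suc_diff_le mult_smult_right del: mult_pCons_left)
  finally show ?thesis by (simp only: h_transform_def sum_distrib_left)
qed

lemma h_transform_diff: "h_transform m (p - q) = h_transform m p - h_transform m q"
  by (simp add: h_transform_def smult_diff_left sum_subtractf)

lemma h_transform_sum: "h_transform m (\<Sum>j\<in>J. smult (c j) (p j)) = (\<Sum>j\<in>J. smult (c j) (h_transform m (p j)))"
proof -
  have "h_transform m (\<Sum>j\<in>J. smult (c j) (p j)) =
      (\<Sum>i\<le>m. \<Sum>j\<in>J. smult (c j) (smult (coeff (p j) i) ([:1, 1:] ^ (m - i))))"
    by (simp add: h_transform_def coeff_sum smult_sum)
  also have "\<dots> = (\<Sum>j\<in>J. \<Sum>i\<le>m. smult (c j) (smult (coeff (p j) i) ([:1, 1:] ^ (m - i))))"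
    by (rule sum.swap)
  also have "\<dots> = (\<Sum>j\<in>J. smult (c j) (h_transform m (p j)))"
  proof -
    have "smult a (sum f A) = (\<Sum>i\<in>A. smult a (f i))" for a :: int and f and A :: "nat set"
      by (induction A rule: infinite_finite_induct) (simp_all add: smult_add_right)
    then show ?thesis by (simp add: h_transform_def)
  qed
  finally show ?thesis .
qed

lemma degree_one_minus_X_power: "degree ([:1, -1:] ^ m :: int poly) \<le> m"
  using degree_power_le[of "[:1, -1:] :: int poly" m] by simp

text \<open>Because 1 - 1 / (x + 1) = x / (x + 1), the factor (x + 1)^m cancels the
  denominators.\<close>

lemma h_transform_one_minus_X_power: "h_transform m ([:1, -1:] ^ m) = monom 1 m"
proof (induction m)
  case 0 then show ?case by (simp add: h_transform_def monom_0 one_pCons)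
next
  case (Suc m)
  let ?p = "[:1, -1:] ^ m :: int poly"
  have "[:1, -1:] ^ Suc m = ?p - pCons 0 ?p" by simp
  then have "h_transform (Suc m) ([:1, -1:] ^ Suc m) = [:1, 1:] * h_transform m ?p - h_transform m ?p"
    by (simp only: h_transform_diff h_transform_pCons_0 h_transform_Suc[OF degree_one_minus_X_power])
  also have "\<dots> = monom 1 (Suc m)" by (simp add: Suc.IH monom_Suc)
  finally show ?case .
qed

text \<open>Each factor 1 / (x + 1) cancels one factor x + 1.\<close>

lemma h_transform_monom_mult: "h_transform (j + m) (monom 1 j * p) = h_transform m p"
proof (induction j)
  case 0 then show ?case by (simp add: monom_0 one_pCons)
next
  case (Suc j) then show ?case by (simp add: monom_Suc h_transform_pCons_0)
qed

text \<open>Divide the defining identity of the \<open>h\<close>-polynomial by \<open>(x + 1)\<^sup>d\<close> and substitute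
  \<open>y = 1 / (x + 1)\<close>.\<close>

lemma h_poly_eq_num_faces:
  "h_poly d \<Gamma> = (\<Sum>j\<le>d. smult (int (num_faces \<Gamma> (int j - 1))) (monom 1 j * [:1, -1:] ^ (d - j)))"
    (is "_ = ?h")
proof -
  have "degree ?h \<le> d"
  proof (rule degree_sum_le)
    fix j assume "j \<in> {..d}"
    then show "degree (smult (int (num_faces \<Gamma> (int j - 1))) (monom 1 j * [:1, -1:] ^ (d - j))) \<le> d"
      using degree_mult_le[of "monom (1 :: int) j" "[:1, -1:] ^ (d - j)"] degree_one_minus_X_power[of "d - j"]
      by (auto simp: degree_monom_eq intro!: order.trans[OF degree_smult_le])
  qed simp
  moreover have "h_transform d ?h = (\<Sum>j\<le>d. monom (int (num_faces \<Gamma> (int j - 1))) (d - j))"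
    unfolding h_transform_sum
  proof (rule sum.cong)
    fix j assume "j \<in> {..d}"
    then have "h_transform d (monom 1 j * [:1, -1:] ^ (d - j)) = monom 1 (d - j)"
      using h_transform_monom_mult[of j "d - j"] h_transform_one_minus_X_power[of "d - j"] by simp
    then show "smult (int (num_faces \<Gamma> (int j - 1))) (h_transform d (monom 1 j * [:1, -1:] ^ (d - j))) =
        monom (int (num_faces \<Gamma> (int j - 1))) (d - j)" by (simp add: smult_monom)
  qed simp
  ultimately have "is_h_poly d \<Gamma> ?h" unfolding is_h_poly_def h_transform_def by blast
  then show ?thesis using ex1_h_poly is_h_poly_h_poly by blast
qed

text \<open>As \<open>aff_dim {} = -1\<close>, the empty face gets 0 and \<open>nat\<close>
  truncates nothing.\<close>

definition num_vertices :: "'a::euclidean_space set \<Rightarrow> nat" where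
  "num_vertices G = nat (aff_dim G + 1)"

text \<open>Replacing face numbers by a sum over the faces themselves allows the exchange with the
  sum over the faces of \<Delta>.\<close>

lemma h_poly_eq_sum_faces:
  assumes fin: "finite \<Gamma>" and dim: "\<And>G. G \<in> \<Gamma> \<Longrightarrow> num_vertices G \<le> d"
  shows "h_poly d \<Gamma> = (\<Sum>G\<in>\<Gamma>. monom 1 (num_vertices G) * [:1, -1:] ^ (d - num_vertices G))"
proof -
  let ?q = "\<lambda>j. monom 1 j * [:1, -1:] ^ (d - j) :: int poly"
  have fib: "{G \<in> \<Gamma>. num_vertices G = j} = {G \<in> \<Gamma>. aff_dim G = int j - 1}" for j
  proof -
    have "num_vertices G = j \<longleftrightarrow> aff_dim G = int j - 1" for G :: "'a set"
      using aff_dim_geq[of G] unfolding num_vertices_def by auto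
    then show ?thesis by simp
  qed
  have "h_poly d \<Gamma> = (\<Sum>j\<le>d. \<Sum>G\<in>{G \<in> \<Gamma>. num_vertices G = j}. ?q (num_vertices G))"
    unfolding h_poly_eq_num_faces
  proof (rule sum.cong)
    fix j
    have "(\<Sum>G\<in>{G \<in> \<Gamma>. num_vertices G = j}. ?q (num_vertices G)) = (\<Sum>G\<in>{G \<in> \<Gamma>. num_vertices G = j}. ?q j)"
      by (rule sum.cong) auto
    also have "\<dots> = smult (int (num_faces \<Gamma> (int j - 1))) (?q j)"
      by (simp add: num_faces_def fib of_nat_poly)
    finally show "smult (int (num_faces \<Gamma> (int j - 1))) (?q j) =
        (\<Sum>G\<in>{G \<in> \<Gamma>. num_vertices G = j}. ?q (num_vertices G))" ..
  qed simp
  also have "\<dots> = (\<Sum>G\<in>\<Gamma>. ?q (num_vertices G))"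
    by (rule sum.group) (use fin dim in auto)
  finally show ?thesis .
qed

lemma sum_Pow_signed_power:
  fixes y :: "'b::comm_ring_1"
  assumes "finite M"
  shows "(\<Sum>T\<in>Pow M. (-1) ^ (card M - card T) * y ^ card T) = (y - 1) ^ card M"
proof -
  have "(\<Prod>i\<in>M. y + - 1) = (\<Sum>T\<in>Pow M. (\<Prod>i\<in>T. y) * (\<Prod>i\<in>M - T. - 1))"
    by (rule prod_add) (rule assms)
  also have "\<dots> = (\<Sum>T\<in>Pow M. (-1) ^ (card M - card T) * y ^ card T)"
    using assms by (intro sum.cong) (auto simp: card_Diff_subset finite_subset mult.commute)
  finally show ?thesis by simp
qed

section \<open>Face-by-face expansion of the local h-polynomial\<close>

context simplex_triangulation begin

lemma num_vertices_le_card: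
  assumes "G \<in> \<Gamma>" "c \<subseteq> V\<^sub>0" "support G \<subseteq> c"
  shows "num_vertices G \<le> card c"
proof -
  have "G \<subseteq> convex hull c" using subset_hull_iff[OF tri_simps(3)[OF assms(1)] assms(2)] assms(3) by simp
  from aff_dim_subset[OF this] show ?thesis
    using aff_dim_hull[OF assms(2)] by (simp add: num_vertices_def)
qed

text \<open>Stanley's formula; the exponent of \<open>1 - x\<close> is the excess of the face \<open>G\<close>.\<close>

lemma local_h_poly_eq:
  "local_h_poly \<Gamma> \<Delta> = (\<Sum>G\<in>\<Gamma>. smult ((-1) ^ (card V\<^sub>0 - card (support G)))
      (monom 1 (num_vertices G + (card V\<^sub>0 - card (support G))) *
        [:1, -1:] ^ (card (support G) - num_vertices G)))"
proof -
  let ?d = "card V\<^sub>0" and ?Y = "[:1, -1:] :: int poly"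
  let ?q = "\<lambda>G k. monom 1 (num_vertices G) * ?Y ^ (k - num_vertices G)"
  let ?s = "\<lambda>c. (-1) ^ (?d - card c) :: int poly"
  have bij: "bij_betw (\<lambda>c. convex hull c) (Pow V\<^sub>0) {F. F face_of \<Delta>}"
    unfolding bij_betw_def
  proof
    show "inj_on (\<lambda>c. convex hull c) (Pow V\<^sub>0)"
    proof (rule inj_onI)
      fix c c' assume c: "c \<in> Pow V\<^sub>0" "c' \<in> Pow V\<^sub>0" "convex hull c = convex hull c'"
      then have "c \<subseteq> c'" "c' \<subseteq> c" using hull_subset_hull_iff[of c c'] hull_subset_hull_iff[of c' c] by auto
      then show "c = c'" by blast
    qed
    show "(\<lambda>c. convex hull c) ` Pow V\<^sub>0 = {F. F face_of \<Delta>}" using face_of_\<Delta> by blast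
  qed
  have "local_h_poly \<Gamma> \<Delta> = (\<Sum>c\<in>Pow V\<^sub>0. (-1) ^ nat (aff_dim \<Delta> - aff_dim (convex hull c)) *
        h_poly (nat (aff_dim (convex hull c) + 1)) (restriction \<Gamma> (convex hull c)))"
    unfolding local_h_poly_def by (rule sum.reindex_bij_betw[OF bij, symmetric])
  also have "\<dots> = (\<Sum>c\<in>Pow V\<^sub>0. \<Sum>G\<in>{G \<in> \<Gamma>. support G \<subseteq> c}. ?s c * ?q G (card c))"
  proof (rule sum.cong)
    fix c assume "c \<in> Pow V\<^sub>0"
    then have c: "c \<subseteq> V\<^sub>0" by simp
    have res: "restriction \<Gamma> (convex hull c) = {G \<in> \<Gamma>. support G \<subseteq> c}"
      using subset_hull_iff[OF tri_simps(3) c] by (auto simp: restriction_def)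
    have "nat (aff_dim \<Delta> - aff_dim (convex hull c)) = ?d - card c"
      using aff_dim_\<Delta> aff_dim_hull[OF c] by simp
    moreover have "nat (aff_dim (convex hull c) + 1) = card c" using aff_dim_hull[OF c] by simp
    moreover have "h_poly (card c) {G \<in> \<Gamma>. support G \<subseteq> c} = (\<Sum>G\<in>{G \<in> \<Gamma>. support G \<subseteq> c}. ?q G (card c))"
      by (rule h_poly_eq_sum_faces) (use tri_simps(1) num_vertices_le_card c in auto)
    ultimately show "(-1) ^ nat (aff_dim \<Delta> - aff_dim (convex hull c)) *
        h_poly (nat (aff_dim (convex hull c) + 1)) (restriction \<Gamma> (convex hull c)) =
        (\<Sum>G\<in>{G \<in> \<Gamma>. support G \<subseteq> c}. ?s c * ?q G (card c))"
      by (simp add: res sum_distrib_left)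
  qed simp
  also have "\<dots> = (\<Sum>G\<in>\<Gamma>. \<Sum>c\<in>{c \<in> Pow V\<^sub>0. support G \<subseteq> c}. ?s c * ?q G (card c))"
    by (rule sum.swap_restrict) (use tri_simps(1) fin_V0 in auto)
  also have "\<dots> = (\<Sum>G\<in>\<Gamma>. smult ((-1) ^ (?d - card (support G)))
      (monom 1 (num_vertices G + (?d - card (support G))) * ?Y ^ (card (support G) - num_vertices G)))"
  proof (rule sum.cong)
    fix G assume G: "G \<in> \<Gamma>"
    define \<sigma> where "\<sigma> = support G"
    define M where "M = V\<^sub>0 - \<sigma>"
    have \<sigma>: "\<sigma> \<subseteq> V\<^sub>0" "finite \<sigma>" "finite M" "card M = ?d - card \<sigma>" "card \<sigma> \<le> ?d"
      using support_subset[of G] fin_V0 finite_subset[of \<sigma> V\<^sub>0]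
      by (auto simp: \<sigma>_def M_def card_Diff_subset finite_subset card_mono)
    have gs: "num_vertices G \<le> card \<sigma>" using num_vertices_le_card[OF G \<sigma>(1)] by (simp add: \<sigma>_def)
    \<comment> \<open>Writing c = \<sigma> \<union> T with \<open>T \<subseteq> M\<close> splits off
      a constant factor; what remains is the expansion of \<open>(?Y - 1) ^ card M\<close>.\<close>
    have "(\<Sum>c\<in>{c \<in> Pow V\<^sub>0. \<sigma> \<subseteq> c}. ?s c * ?q G (card c)) =
        (\<Sum>T\<in>Pow M. ?s (\<sigma> \<union> T) * ?q G (card (\<sigma> \<union> T)))"
      by (rule sum.reindex_bij_witness[of _ "\<lambda>T. \<sigma> \<union> T" "\<lambda>c. c - \<sigma>"])
        (use \<sigma>(1) in \<open>auto simp: M_def Un_absorb1\<close>)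
    also have "\<dots> = (\<Sum>T\<in>Pow M. (monom 1 (num_vertices G) * ?Y ^ (card \<sigma> - num_vertices G)) *
        ((-1) ^ (card M - card T) * ?Y ^ card T))"
    proof (rule sum.cong)
      fix T assume "T \<in> Pow M"
      then have T: "T \<subseteq> M" "finite T" using \<sigma>(3) finite_subset by auto
      then have "card (\<sigma> \<union> T) = card \<sigma> + card T"
        using \<sigma>(2) by (intro card_Un_disjoint) (auto simp: M_def)
      moreover from this have "?d - card (\<sigma> \<union> T) = card M - card T" using \<sigma>(4) by simp
      moreover have "card (\<sigma> \<union> T) - num_vertices G = card \<sigma> - num_vertices G + card T"
        using gs calculation(1) by simp
      ultimately show "?s (\<sigma> \<union> T) * ?q G (card (\<sigma> \<union> T)) =
          (monom 1 (num_vertices G) * ?Y ^ (card \<sigma> - num_vertices G)) *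
          ((-1) ^ (card M - card T) * ?Y ^ card T)"
        by (simp only: power_add ac_simps)
    qed simp
    also have "\<dots> = (monom 1 (num_vertices G) * ?Y ^ (card \<sigma> - num_vertices G)) * (?Y - 1) ^ card M"
      by (simp only: sum_distrib_left[symmetric] sum_Pow_signed_power[OF \<sigma>(3)])
    \<comment> \<open>Since \<open>?Y\<close> is 1 - x, this is -x: it supplies both the sign and
      the extra power of x.\<close>
    also have "?Y - 1 = monom (- 1) 1" by (simp add: monom_Suc monom_0 one_pCons)
    also have "monom (- 1 :: int) 1 ^ card M = smult ((-1) ^ card M) (monom 1 (card M))"
      by (simp add: monom_power smult_monom)
    also have "monom 1 (num_vertices G) * ?Y ^ (card \<sigma> - num_vertices G) *
        smult ((-1) ^ card M) (monom 1 (card M)) = smult ((-1) ^ card M)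
        (monom 1 (num_vertices G) * monom 1 (card M) * ?Y ^ (card \<sigma> - num_vertices G))"
      by (simp only: mult_smult_right mult_smult_left ac_simps)
    also have "monom 1 (num_vertices G) * monom 1 (card M) = (monom 1 (num_vertices G + card M) :: int poly)"
      by (simp add: mult_monom)
    finally show "(\<Sum>c\<in>{c \<in> Pow V\<^sub>0. support G \<subseteq> c}. ?s c * ?q G (card c)) =
        smult ((-1) ^ (?d - card (support G)))
        (monom 1 (num_vertices G + (?d - card (support G))) * ?Y ^ (card (support G) - num_vertices G))"
      unfolding \<sigma>(4) \<sigma>_def .
  qed simp
  finally show ?thesis .
qed

lemma coeff_one_minus_X_power_0: "coeff ([:1, -1:] ^ m :: int poly) 0 = 1"
  by (induction m) (simp_all add: coeff_mult)

lemma coeff_local_h_poly: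
  "coeff (local_h_poly \<Gamma> \<Delta>) k = (\<Sum>G\<in>\<Gamma>. (-1) ^ (card V\<^sub>0 - card (support G)) *
      (let a = num_vertices G + (card V\<^sub>0 - card (support G)) in
        if k < a then 0 else coeff ([:1, -1:] ^ (card (support G) - num_vertices G)) (k - a)))"
  by (simp add: local_h_poly_eq coeff_sum coeff_monom_mult Let_def cong: if_cong)

lemma num_vertices_eq_0: "num_vertices G = 0 \<longleftrightarrow> G = {}"
  using aff_dim_geq[of G] aff_dim_empty[of G] unfolding num_vertices_def by linarith

lemma support_empty [simp]: "support {} = {}"
  by (simp add: support_def)

lemma card_support_le: "card (support G) \<le> card V\<^sub>0"
  using card_mono[OF fin_V0 support_subset] .

text \<open>The term of \<open>G\<close> starts in degree \<open>num_vertices G\<close> plus the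
  codimension of its carrier. For the empty face this is \<open>card V\<^sub>0\<close>, so only
  interior vertices reach degree 1.\<close>

lemma coeff_1_local_h_poly:
  assumes d: "card V\<^sub>0 \<ge> 3"
  shows "coeff (local_h_poly \<Gamma> \<Delta>) 1 =
    int (card {G \<in> \<Gamma>. num_vertices G = 1 \<and> card (support G) = card V\<^sub>0})"
proof -
  have "coeff (local_h_poly \<Gamma> \<Delta>) 1 =
      (\<Sum>G\<in>\<Gamma>. if num_vertices G = 1 \<and> card (support G) = card V\<^sub>0 then 1 else 0)"
    unfolding coeff_local_h_poly
  proof (rule sum.cong)
    fix G assume G: "G \<in> \<Gamma>"
    have "num_vertices G \<noteq> 0 \<or> card (support G) = 0" using num_vertices_eq_0[of G] by auto
    then show "(-1) ^ (card V\<^sub>0 - card (support G)) *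
      (let a = num_vertices G + (card V\<^sub>0 - card (support G)) in
        if 1 < a then 0 else coeff ([:1, -1:] ^ (card (support G) - num_vertices G)) (1 - a)) =
      (if num_vertices G = 1 \<and> card (support G) = card V\<^sub>0 then 1 else (0 :: int))"
      using d card_support_le[of G] by (auto simp: Let_def coeff_one_minus_X_power_0)
  qed simp
  then show ?thesis using tri_simps(1) by (simp add: sum.If_cases Int_def)
qed

lemma coeff_2_local_h_poly:
  assumes d: "card V\<^sub>0 \<ge> 3"
    and no: "\<And>G. G \<in> \<Gamma> \<Longrightarrow> \<not> (num_vertices G = 1 \<and> card (support G) = card V\<^sub>0)"
  shows "coeff (local_h_poly \<Gamma> \<Delta>) 2 =
    int (card {G \<in> \<Gamma>. num_vertices G = 2 \<and> card (support G) = card V\<^sub>0}) -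
    int (card {G \<in> \<Gamma>. num_vertices G = 1 \<and> Suc (card (support G)) = card V\<^sub>0})"
proof -
  have "coeff (local_h_poly \<Gamma> \<Delta>) 2 =
      (\<Sum>G\<in>\<Gamma>. (if num_vertices G = 2 \<and> card (support G) = card V\<^sub>0 then 1 else 0) -
        (if num_vertices G = 1 \<and> Suc (card (support G)) = card V\<^sub>0 then 1 else 0))"
    unfolding coeff_local_h_poly
  proof (rule sum.cong)
    fix G assume G: "G \<in> \<Gamma>"
    define g where "g = num_vertices G"
    define s where "s = card V\<^sub>0 - card (support G)"
    have s: "card (support G) = card V\<^sub>0 - s" "s \<le> card V\<^sub>0" using card_support_le[of G] by (auto simp: s_def)
    have g: "g \<noteq> 0 \<or> s = card V\<^sub>0" using num_vertices_eq_0[of G] by (auto simp: g_def s_def)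
    have no': "\<not> (g = 1 \<and> s = 0)" using no[OF G] s by (auto simp: g_def)
    \<comment> \<open>Without interior vertices no term starts below degree 2. Those starting there
      are the internal edges, with sign +1, and the facet vertices, with sign -1.\<close>
    consider "g + s > 2" | "g = 2" "s = 0" | "g = 1" "s = 1" using g no' d by linarith
    then show "(-1) ^ (card V\<^sub>0 - card (support G)) *
      (let a = num_vertices G + (card V\<^sub>0 - card (support G)) in
        if 2 < a then 0 else coeff ([:1, -1:] ^ (card (support G) - num_vertices G)) (2 - a)) =
      (if num_vertices G = 2 \<and> card (support G) = card V\<^sub>0 then 1 else 0) -
        (if num_vertices G = 1 \<and> Suc (card (support G)) = card V\<^sub>0 then 1 else (0 :: int))"
      unfolding g_def[symmetric] s_def[symmetric] s(1)
      by cases (use d s(2) in \<open>auto simp: Let_def coeff_one_minus_X_power_0\<close>)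
  qed simp
  then show ?thesis using tri_simps(1) by (simp add: sum_subtractf sum.If_cases Int_def)
qed

end

subsection \<open>The internal edge graph\<close>

context simplex_triangulation begin

text \<open>Here the geometry is handed over to the combinatorial core; the absence of interior
  vertices makes every label set nonempty.\<close>

lemma facet_labelled_complex_tops:
  assumes d: "card V\<^sub>0 = n + 1" "n \<ge> 3"
    and no: "\<And>v. {v} \<in> \<Gamma> \<Longrightarrow> facets_at v \<noteq> {}"
  shows "facet_labelled_complex V\<^sub>0 tops facets_at n"
proof
  show "card V\<^sub>0 = n + 1" "3 \<le> n" by fact+
  show "finite tops" using tri_simps(1) by (simp add: tops_def)
  obtain v where "v \<in> V\<^sub>0" using d by fastforce
  then have "v \<in> \<Delta>" using hull_inc[of v V\<^sub>0 convex] by (simp add: \<Delta>_eq)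
  then obtain A where "A \<in> \<Gamma>" "aff_dim A = aff_dim \<Delta>" using ex_top_containing by blast
  then have "verts A \<in> tops" by (simp add: tops_def)
  then show "tops \<noteq> {}" by blast
  show "card C = n + 1" if C: "C \<in> tops" for C
  proof -
    obtain S where "S \<in> \<Gamma>" "aff_dim S = aff_dim \<Delta>" "C = verts S" using C by (rule topsE)
    then show ?thesis using verts_simplex(3)[of S] aff_dim_\<Delta> d(1) by simp
  qed
  show "facets_at v \<subseteq> V\<^sub>0" for v by (rule facets_at_subset)
  show "facets_at v \<noteq> {}" if "v \<in> \<Union>tops" for v using no Union_tops that by blast
  show "card S + card J \<le> n + 1"
    if "C \<in> tops" "S \<subseteq> C" "J \<subseteq> V\<^sub>0" "\<And>v. v \<in> S \<Longrightarrow> J \<subseteq> facets_at v" for C S J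
    using top_bound[OF that] d(1) by simp
  show "P C'"
    if "C \<in> tops" "C' \<in> tops" "\<tau> \<subseteq> C" "\<tau> \<subseteq> C'" "P C"
      "\<And>A B. \<lbrakk>A \<in> tops; B \<in> tops; P A; \<tau> \<subseteq> A \<inter> B; card (A \<inter> B) = n;
        \<And>c. c \<in> V\<^sub>0 \<Longrightarrow> \<exists>v\<in>A \<inter> B. c \<notin> facets_at v\<rbrakk> \<Longrightarrow> P B" for C C' \<tau> P
  proof (rule tops_ridge_connected[where P = P, OF that(1-5)])
    show "V\<^sub>0 \<noteq> {}" using d by auto
    fix A B assume "A \<in> tops" "B \<in> tops" "P A" "\<tau> \<subseteq> A \<inter> B" "Suc (card (A \<inter> B)) = card V\<^sub>0"
      "\<And>c. c \<in> V\<^sub>0 \<Longrightarrow> \<exists>v\<in>A \<inter> B. c \<notin> facets_at v"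
    then show "P B" using d(1) by (intro that(6)[of A B]) simp_all
  qed
  show "\<exists>\<tau>. card \<tau> + card T = n + 1 \<and> (\<exists>C\<in>tops. \<tau> \<subseteq> C) \<and> (\<forall>v\<in>\<tau>. T \<subseteq> facets_at v)"
    if "T \<subseteq> V\<^sub>0" "card T \<le> n" for T
  proof -
    have "T \<noteq> V\<^sub>0" using that(2) d(1) by auto
    from ex_simplex_in_face[OF that(1) this] show ?thesis unfolding d(1) .
  qed
  show "\<exists>C'\<in>tops. \<tau> \<subseteq> C' \<and> n \<le> card {v \<in> C'. a \<in> facets_at v}"
    if "C \<in> tops" "\<tau> \<subseteq> C" "\<tau> \<noteq> {}" "a \<in> V\<^sub>0" "\<And>v. v \<in> \<tau> \<Longrightarrow> a \<in> facets_at v" for C \<tau> a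
    using ex_boundary_ridge[OF that] unfolding d(1) by simp
qed

lemma convex_hull_edge:
  assumes S: "S \<in> \<Gamma>" and e: "S = convex hull e" "card e = 2"
  shows "verts S = e"
proof -
  obtain a b where ab: "e = {a, b}" "a \<noteq> b" using e(2) by (meson card_2_iff)
  show ?thesis
    using extreme_point_of_convex_hull_affine_independent[OF affine_independent_2[of a b]] e(1) ab(1)
    by (auto simp: verts_def)
qed

lemma support_hull: "support (convex hull e) = {i \<in> V\<^sub>0. \<not> e \<subseteq> facet i}"
proof -
  have "convex hull e \<subseteq> facet i \<longleftrightarrow> e \<subseteq> facet i" for i
    using hull_subset[of e convex] hull_minimal[of e "facet i" convex] by (auto simp: facet_def)
  then show ?thesis by (simp add: support_def)
qed

lemma support_hull_pair: "support (convex hull {a, b}) = V\<^sub>0 \<longleftrightarrow> facets_at a \<inter> facets_at b = {}"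
  unfolding support_hull facets_at_def by auto

lemma internal_edges_iff:
  "e \<in> internal_edges \<Gamma> \<Delta> \<longleftrightarrow> card e = 2 \<and> convex hull e \<in> \<Gamma> \<and> support (convex hull e) = V\<^sub>0"
  using carrier_face_eq_\<Delta>_iff[OF tri_simps(3)] by (auto simp: internal_edges_def)

text \<open>This matches \<open>edges\<close> of the core: an edge is carried by \<Delta> exactly
  when no facet contains both ends, and every nonempty face extends to a top-dimensional
  one.\<close>

lemma internal_edges_eq:
  "internal_edges \<Gamma> \<Delta> = {{a, b} | a b. a \<noteq> b \<and> facets_at a \<inter> facets_at b = {} \<and> (\<exists>C\<in>tops. {a, b} \<subseteq> C)}"
    (is "?L = ?R")
proof
  show "?L \<subseteq> ?R"
  proof
    fix e assume "e \<in> ?L"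
    then have e: "card e = 2" "convex hull e \<in> \<Gamma>" "support (convex hull e) = V\<^sub>0"
      by (auto simp: internal_edges_iff)
    then obtain a b where ab: "e = {a, b}" "a \<noteq> b" by (meson card_2_iff)
    have "convex hull e \<noteq> {}" using ab by simp
    then obtain A where "verts (convex hull e) \<subseteq> verts A" "verts A \<in> tops"
      using ex_top_above[OF e(2)] by blast
    then have "\<exists>C\<in>tops. {a, b} \<subseteq> C" using convex_hull_edge[OF e(2) refl e(1)] ab(1) by blast
    then show "e \<in> ?R" using ab e(3) support_hull_pair[of a b] by blast
  qed
  show "?R \<subseteq> ?L"
  proof
    fix e assume "e \<in> ?R"
    then obtain a b C where e: "e = {a, b}" "a \<noteq> b" "facets_at a \<inter> facets_at b = {}" "C \<in> tops" "e \<subseteq> C"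
      by blast
    obtain S where S: "S \<in> \<Gamma>" "C = verts S" using e(4) by (rule topsE)
    then have "convex hull e \<in> \<Gamma>" using hull_in_\<Gamma> e(5) by simp
    then show "e \<in> ?L" using e support_hull_pair[of a b] by (simp add: internal_edges_iff)
  qed
qed

lemma finite_vertices: "finite {v. {v} \<in> \<Gamma>}"
proof -
  have "finite ((\<lambda>v. {v}) ` {v. {v} \<in> \<Gamma>})" by (rule finite_subset[OF _ tri_simps(1)]) auto
  then show ?thesis by (rule finite_imageD) simp
qed

lemma card_vertices:
  "card {G \<in> \<Gamma>. num_vertices G = 1 \<and> Q G} = card {v. {v} \<in> \<Gamma> \<and> Q {v}}"
proof -
  have "{G \<in> \<Gamma>. num_vertices G = 1 \<and> Q G} = (\<lambda>v. {v}) ` {v. {v} \<in> \<Gamma> \<and> Q {v}}"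
  proof -
    have "num_vertices G = 1 \<longleftrightarrow> (\<exists>v. G = {v})" for G :: "'a set"
      using aff_dim_eq_0[of G] by (auto simp: num_vertices_def)
    then show ?thesis by auto
  qed
  then show ?thesis by (simp add: card_image)
qed

lemma card_internal_edges:
  "card {G \<in> \<Gamma>. num_vertices G = 2 \<and> card (support G) = card V\<^sub>0} = card (internal_edges \<Gamma> \<Delta>)"
proof (rule bij_betw_same_card[OF bij_betwI])
  have supp: "card (support G) = card V\<^sub>0 \<longleftrightarrow> support G = V\<^sub>0" for G
    using card_subset_eq[OF fin_V0 support_subset] by auto
  show "verts \<in> {G \<in> \<Gamma>. num_vertices G = 2 \<and> card (support G) = card V\<^sub>0} \<rightarrow> internal_edges \<Gamma> \<Delta>"
  proof
    fix G assume "G \<in> {G \<in> \<Gamma>. num_vertices G = 2 \<and> card (support G) = card V\<^sub>0}"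
    then have G: "G \<in> \<Gamma>" "num_vertices G = 2" "support G = V\<^sub>0" by (auto simp: supp)
    then have "card (verts G) = 2" using verts_simplex(3)[OF G(1)] by (simp add: num_vertices_def)
    then show "verts G \<in> internal_edges \<Gamma> \<Delta>"
      using G verts_simplex(2)[OF G(1)] by (simp add: internal_edges_iff)
  qed
  show "(\<lambda>e. convex hull e) \<in> internal_edges \<Gamma> \<Delta> \<rightarrow>
      {G \<in> \<Gamma>. num_vertices G = 2 \<and> card (support G) = card V\<^sub>0}"
  proof
    fix e assume "e \<in> internal_edges \<Gamma> \<Delta>"
    then have e: "card e = 2" "convex hull e \<in> \<Gamma>" "support (convex hull e) = V\<^sub>0"
      by (auto simp: internal_edges_iff)
    have "num_vertices (convex hull e) = 2"
      using verts_simplex(3)[OF e(2)] convex_hull_edge[OF e(2) refl e(1)] e(1) by (simp add: num_vertices_def)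
    then show "convex hull e \<in> {G \<in> \<Gamma>. num_vertices G = 2 \<and> card (support G) = card V\<^sub>0}" using e by simp
  qed
  show "convex hull (verts G) = G" if "G \<in> {G \<in> \<Gamma>. num_vertices G = 2 \<and> card (support G) = card V\<^sub>0}" for G
    using that verts_simplex(2) by simp
  show "verts (convex hull e) = e" if "e \<in> internal_edges \<Gamma> \<Delta>" for e
    using that convex_hull_edge by (simp add: internal_edges_iff)
qed

lemma facets_at_nonempty:
  assumes "card V\<^sub>0 \<ge> 3" "coeff (local_h_poly \<Gamma> \<Delta>) 1 = 0" "{v} \<in> \<Gamma>"
  shows "facets_at v \<noteq> {}"
proof
  assume "facets_at v = {}"
  then have "v \<in> {v. {v} \<in> \<Gamma> \<and> card (support {v}) = card V\<^sub>0}"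
    using assms(3) card_support_singleton[of v] by simp
  moreover have "finite {v. {v} \<in> \<Gamma> \<and> card (support {v}) = card V\<^sub>0}"
    using finite_vertices by (rule rev_finite_subset) blast
  ultimately have "card {v. {v} \<in> \<Gamma> \<and> card (support {v}) = card V\<^sub>0} \<noteq> 0" by auto
  then show False using coeff_1_local_h_poly[OF assms(1)] assms(2)
      card_vertices[of "\<lambda>G. card (support G) = card V\<^sub>0"] by simp
qed

lemma card_internal_edges_eq_facet_vertices:
  assumes d: "card V\<^sub>0 \<ge> 3"
    and l: "coeff (local_h_poly \<Gamma> \<Delta>) 1 = 0" "coeff (local_h_poly \<Gamma> \<Delta>) 2 = 0"
  shows "card (internal_edges \<Gamma> \<Delta>) = card {v. {v} \<in> \<Gamma> \<and> card (facets_at v) = 1}"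
proof -
  have no: "\<not> (num_vertices G = 1 \<and> card (support G) = card V\<^sub>0)" if G: "G \<in> \<Gamma>" for G
  proof -
    have "finite {G \<in> \<Gamma>. num_vertices G = 1 \<and> card (support G) = card V\<^sub>0}" using tri_simps(1) by simp
    moreover have "card {G \<in> \<Gamma>. num_vertices G = 1 \<and> card (support G) = card V\<^sub>0} = 0"
      using coeff_1_local_h_poly[OF d] l(1) by simp
    ultimately show ?thesis using G by auto
  qed
  have "Suc (card (support {v})) = card V\<^sub>0 \<longleftrightarrow> card (facets_at v) = 1" for v
    using card_support_singleton[of v] by linarith
  then show ?thesis
    using coeff_2_local_h_poly[OF d no] l(2) card_internal_edges
      card_vertices[of "\<lambda>G. Suc (card (support G)) = card V\<^sub>0"] by simp
qed

lemma internal_edge_graph_trees: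
  assumes d: "card V\<^sub>0 = n + 1" "n \<ge> 3"
    and l: "coeff (local_h_poly \<Gamma> \<Delta>) 1 = 0" "coeff (local_h_poly \<Gamma> \<Delta>) 2 = 0"
    and comp: "(W, F) \<in> graph_components (internal_vertices \<Gamma> \<Delta>) (internal_edges \<Gamma> \<Delta>)"
  shows "tree_graph W F \<and> (\<exists>!v. v \<in> W \<and> aff_dim (carrier_face \<Delta> {v}) \<le> aff_dim \<Delta> - 2)"
proof -
  let ?V = "internal_vertices \<Gamma> \<Delta>" and ?E = "internal_edges \<Gamma> \<Delta>"
  have d3: "card V\<^sub>0 \<ge> 3" using d by simp
  interpret facet_labelled_complex V\<^sub>0 tops facets_at n
    by (rule facet_labelled_complex_tops[OF d]) (rule facets_at_nonempty[OF d3 l(1)])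
  have E: "?E = edges" unfolding internal_edges_eq edges_def ..
  have V: "{v} \<in> \<Gamma>" if "v \<in> ?V" for v using that by (simp add: internal_vertices_def)
  have EV: "\<Union>?E \<subseteq> ?V"
    using internal_edges_subset_vertices tri unfolding geometric_triangulation_def by blast
  define A where "A = {v. {v} \<in> \<Gamma> \<and> card (facets_at v) = 1}"
  have A_eq: "A = {v \<in> \<Union>tops. card (facets_at v) = 1}" unfolding A_def using Union_tops by blast
  have "tree_graph W F \<and> (\<exists>!v. v \<in> W \<and> v \<notin> A)"
  proof (rule graph_components_tree_unique[OF _ _ _ _ _ comp])
    show "finite ?V" using V by (intro finite_subset[OF _ finite_vertices]) blast
    show "card e = 2 \<and> e \<subseteq> ?V" if "e \<in> ?E" for e
    proof
      show "card e = 2" using that by (simp add: internal_edges_iff)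
      show "e \<subseteq> ?V" using that EV by blast
    qed
    show "A \<subseteq> ?V"
    proof
      fix v assume v: "v \<in> A"
      then obtain i where "facets_at v = {i}" by (auto simp: A_def card_1_singleton_iff)
      then have "v \<in> \<Union>edges" using v facet_vertex_in_edge[of v i] unfolding A_eq by simp
      then show "v \<in> ?V" using EV E by blast
    qed
    show card: "card ?E = card A" unfolding A_def by (rule card_internal_edges_eq_facet_vertices[OF d3 l])
    show "\<exists>w\<in>graph_class ?E v. w \<notin> A" if "v \<in> ?V" for v
    proof -
      have "v \<in> \<Union>tops" using V[OF that] Union_tops by blast
      then have "\<exists>w\<in>graph_class edges v. card (facets_at w) \<noteq> 1"
        using ex_deep_vertex_in_class card unfolding E A_eq by blast
      then show ?thesis unfolding E A_def by blast
    qed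
  qed
  \<comment> \<open>The carrier of \<open>v\<close> has codimension
    \<open>card (facets_at v)\<close>. This is never 0, so differing from 1 means being at least
    2.\<close>
  moreover have "v \<notin> A \<longleftrightarrow> aff_dim (carrier_face \<Delta> {v}) \<le> aff_dim \<Delta> - 2" if "v \<in> W" for v
  proof -
    have "W \<subseteq> ?V" using comp by (auto simp: graph_components_def)
    then have v: "{v} \<in> \<Gamma>" using V that by blast
    have "aff_dim (carrier_face \<Delta> {v}) = int (card (support {v})) - 1"
      using carrier_face_eq[OF tri_simps(3)[OF v]] aff_dim_hull[OF support_subset] by simp
    moreover have "card (facets_at v) \<noteq> 0"
      using facets_at_nonempty[OF d3 l(1) v] finite_subset[OF facets_at_subset fin_V0] by simp
    ultimately show ?thesis
      using v card_support_singleton[of v] aff_dim_\<Delta> unfolding A_def by auto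
  qed
  ultimately show ?thesis by metis
qed

end

theorem theorem1p3:
  fixes \<Gamma> :: "'a::euclidean_space set set" and \<Delta> :: "'a set" and n :: int
  assumes "n simplex \<Delta>" and "n \<ge> 3"
    and "geometric_triangulation \<Gamma> \<Delta>"
    and "coeff (local_h_poly \<Gamma> \<Delta>) 1 = 0" and "coeff (local_h_poly \<Gamma> \<Delta>) 2 = 0"
  shows "\<forall>(W, F) \<in> graph_components (internal_vertices \<Gamma> \<Delta>) (internal_edges \<Gamma> \<Delta>).
           tree_graph W F \<and>
           (\<exists>!v. v \<in> W \<and> aff_dim (carrier_face \<Delta> {v}) \<le> aff_dim \<Delta> - 2)"
proof -
  obtain C where C: "\<not> affine_dependent C" "int (card C) = n + 1" "\<Delta> = convex hull C"
    using assms(1) by (auto simp: simplex_def)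
  interpret simplex_triangulation \<Gamma> \<Delta> C
    by unfold_locales (use C assms(3) in simp_all)
  have "card C = nat n + 1" "nat n \<ge> 3" using C(2) assms(2) by linarith+
  then show ?thesis using internal_edge_graph_trees assms(4,5) by blast
qed

end
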